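(* Let $(L_t)_{t\ge0}$ be a Lévy process as in the context whose Lévy density satisfies $\int x^2n(x)\,dx<\infty$. Assume that $n\to\infty$, $\Delta=\Delta_n\to0$ and $n\Delta\to\infty$. (i) If $\int|x|^{2+\varepsilon}n(x)\,dx<\infty$ for some $\varepsilon>0$, then $\sqrt{n\Delta}(\hat b-b)$ converges in distribution to $\mathcal{N}(0,c_2)$. (ii) Let $\ell\ge2$ be an integer. If $\int|x|^{2(\ell+\varepsilon)}n(x)\,dx<\infty$ for some $\varepsilon>0$ and $n\Delta^3$ tends to $0$, then $\sqrt{n\Delta}(\hat c_\ell-c_\ell)$ converges in distribution to $\mathcal{N}(0,c_{2\ell})$.
   Context: Under $\int x^2n(x)\,dx<\infty$, $(L_t)$ is a real Lévy process with characteristic function $\mathbb{E}(e^{iuL_t})=\exp\{t(iub-\frac12u^2\sigma^2+\int_{\mathbb{R}}(e^{iux}-1-iux)n(x)\,dx)\}$, where $b=\mathbb{E}L_1$, $\sigma^2\ge0$ and $n(\cdot)$ is the Lévy density. Observations: $Z_k=L_{k\Delta}-L_{(k-1)\Delta}$, $1\le k\le n$. Empirical means: $\hat b=\frac1{n\Delta}\sum_{k=1}^nZ_k$ and $\hat c_\ell=\frac1{n\Delta}\sum_{k=1}^nZ_k^\ell$ for $\ell\ge2$. Limits: $c_2=\sigma^2+\int x^2n(x)\,dx$ and $c_\ell=\int x^\ell n(x)\,dx$ for $\ell\ge3$. *)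

theory Defs
  imports "HOL-Probability.Probability"
begin

text \<open>
  The time parameter ranges over the reals, but only times \<open>t \<ge> 0\<close> are constrained.
  Path regularity is imposed in the form of continuity in probability; this is implied by
  right-continuity of paths with left limits, so processes with such paths are included.
\<close>

definition levy_process :: "'a measure \<Rightarrow> (real \<Rightarrow> 'a \<Rightarrow> real) \<Rightarrow> bool" where
  "levy_process M L \<longleftrightarrow>
     prob_space M \<and>
     (\<forall>t\<ge>0. L t \<in> borel_measurable M) \<and>
     (AE \<omega> in M. L 0 \<omega> = 0) \<and>
     (\<forall>(m::nat) (t::nat \<Rightarrow> real). 0 \<le> t 0 \<and> (\<forall>i<m. t i \<le> t (Suc i)) \<longrightarrow>
        prob_space.indep_vars M (\<lambda>_. borel) (\<lambda>i \<omega>. L (t (Suc i)) \<omega> - L (t i) \<omega>) {..<m}) \<and>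
     (\<forall>s\<ge>0. \<forall>t\<ge>0. distr M borel (\<lambda>\<omega>. L (s + t) \<omega> - L s \<omega>) = distr M borel (L t)) \<and>
     (\<forall>t\<ge>0. \<forall>e>0.
        ((\<lambda>s. measure M {\<omega> \<in> space M. e < \<bar>L s \<omega> - L t \<omega>\<bar>}) \<longlongrightarrow> 0) (at t within {0..}))"

text \<open>
  The integrand is bounded in modulus by \<open>u\<^sup>2 * x\<^sup>2 * \<nu> x / 2\<close>, so the integral converges whenever
  \<open>x\<^sup>2 * \<nu> x\<close> is integrable, and no truncation function is needed.
\<close>

definition levy_exponent :: "real \<Rightarrow> real \<Rightarrow> (real \<Rightarrow> real) \<Rightarrow> real \<Rightarrow> complex" where
  "levy_exponent b \<sigma> \<nu> u =
     \<i> * u * b - u\<^sup>2 * \<sigma>\<^sup>2 / 2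
       + (CLINT x|lborel. (iexp (u * x) - 1 - \<i> * u * x) * \<nu> x)"

text \<open>
  The mean \<open>prob_space.expectation M (L 1)\<close> is a genuine one: if \<open>x\<^sup>2 * \<nu> x\<close> is integrable, the
  formula for the characteristic function forces \<open>L 1\<close> to be square integrable.
\<close>

definition levy_process_with_density ::
    "'a measure \<Rightarrow> (real \<Rightarrow> 'a \<Rightarrow> real) \<Rightarrow> real \<Rightarrow> (real \<Rightarrow> real) \<Rightarrow> bool" where
  "levy_process_with_density M L \<sigma> \<nu> \<longleftrightarrow>
     levy_process M L \<and>
     \<nu> \<in> borel_measurable borel \<and> (\<forall>x. 0 \<le> \<nu> x) \<and>
     integrable lborel (\<lambda>x. x\<^sup>2 * \<nu> x) \<and>
     (\<forall>t\<ge>0. \<forall>u. char (distr M borel (L t)) u =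
        exp (t * levy_exponent (prob_space.expectation M (L 1)) \<sigma> \<nu> u))"

definition increment :: "(real \<Rightarrow> 'a \<Rightarrow> real) \<Rightarrow> real \<Rightarrow> nat \<Rightarrow> 'a \<Rightarrow> real" where
  "increment L d k \<omega> = L (real k * d) \<omega> - L ((real k - 1) * d) \<omega>"

definition b_hat :: "(real \<Rightarrow> 'a \<Rightarrow> real) \<Rightarrow> nat \<Rightarrow> real \<Rightarrow> 'a \<Rightarrow> real" where
  "b_hat L n d \<omega> = 1 / (real n * d) * (\<Sum>k=1..n. increment L d k \<omega>)"

definition c_hat :: "(real \<Rightarrow> 'a \<Rightarrow> real) \<Rightarrow> nat \<Rightarrow> nat \<Rightarrow> real \<Rightarrow> 'a \<Rightarrow> real" where
  "c_hat L l n d \<omega> = 1 / (real n * d) * (\<Sum>k=1..n. increment L d k \<omega> ^ l)"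

text \<open>Only used for \<open>l \<ge> 2\<close>.\<close>

definition c_lim :: "real \<Rightarrow> (real \<Rightarrow> real) \<Rightarrow> nat \<Rightarrow> real" where
  "c_lim \<sigma> \<nu> l = (if l = 2 then \<sigma>\<^sup>2 else 0) + (LINT x|lborel. x ^ l * \<nu> x)"

text \<open>
  The second argument is the variance. Variance 0 must be treated separately, because
  \<open>normal_density m 0\<close> is identically 0; the degenerate case is the point mass at the mean.
\<close>

definition normal_law :: "real \<Rightarrow> real \<Rightarrow> real measure" where
  "normal_law m v =
     (if v = 0 then return borel m else density lborel (normal_density m (sqrt v)))"

end

theory Submission
  imports Defs
begin

text \<open>
  The estimators are functions of the increments \<open>Z\<close> of the process over a grid, and everything is read off
  the characteristic function \<open>exp (t * \<psi> u)\<close> of \<open>L t\<close>, where \<open>\<psi>\<close> is the Levy exponent.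

  For the mean, the increments telescope and the estimator is \<open>L T / T\<close> with \<open>T = n * \<Delta>\<close>. After centring
  and rescaling, its characteristic function is the exponential of
  \<open>T * \<psi> (u / sqrt T) - \<i> * u * sqrt T * b\<close>, which tends to \<open>- c\<^sub>2 * u\<^sup>2 / 2\<close> because \<open>\<psi>\<close> has second
  derivative \<open>- c\<^sub>2\<close> at \<open>0\<close> (\<open>levy_exponent_rescaled_limit\<close>).

  For the powers of order \<open>l \<ge> 2\<close>, the estimation error is a row sum of independent, identically
  distributed variables, and Lindeberg's conditions have to be checked (\<open>char_power_tendsto_normal\<close>). This
  needs the moments of an increment for small \<open>\<Delta>\<close>, whose existence follows from smoothness. Since the Levy measure has moments of orders 2 to \<open>2 * l\<close>, the exponent is \<open>2 * l\<close> times
  differentiable, hence so is \<open>exp (\<Delta> * \<psi>)\<close>; a characteristic function that is differentiable to an even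
  order forces the corresponding moment to exist (\<open>moments_of_smooth_char\<close>). The Leibniz
  rule shows that the derivatives of \<open>exp (\<Delta> * \<psi>)\<close> are those of \<open>\<Delta> * \<psi>\<close> up to \<open>O(\<Delta>\<^sup>2)\<close>
  (\<open>exp_deriv_first_order\<close>). At \<open>u = 0\<close> this says that \<open>Z ^ m\<close> has mean \<open>\<Delta> * c\<^sub>m + O(\<Delta>\<^sup>2)\<close> for
  \<open>2 \<le> m \<le> 2 * l\<close>. The error term for \<open>m = l\<close> produces a bias of order \<open>sqrt (n * \<Delta>\<^sup>3)\<close>, which
  vanishes in the limit, and the case \<open>m = 2 * l\<close> gives the variance. For other \<open>u\<close> it says that the measures
  \<open>x ^ (2 * l) / \<Delta>\<close> against the law of \<open>Z\<close> converge weakly to \<open>x ^ (2 * l)\<close> against the Levy measure.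
  A weakly convergent sequence of finite measures is tight, and this tightness is the Lindeberg condition
  (\<open>small_time_uniform_integrability\<close>).
\<close>

section \<open>Differentiating Fourier integrals\<close>

lemma has_vector_derivative_at_iff_tendsto:
  "(f has_vector_derivative D) (at x) \<longleftrightarrow> ((\<lambda>h. (f (x + h) - f x) /\<^sub>R h) \<longlongrightarrow> D) (at 0)"
proof -
  have "((\<lambda>h. (f (x + h) - f x) /\<^sub>R h) \<longlongrightarrow> D) (at 0)
      \<longleftrightarrow> ((\<lambda>h. norm ((f (x + h) - f x) /\<^sub>R h - D)) \<longlongrightarrow> 0) (at 0)"
    by (subst Lim_null) (rule tendsto_norm_zero_iff[symmetric])
  also have "\<dots> \<longleftrightarrow> ((\<lambda>h. norm (f (x + h) - f x - h *\<^sub>R D) / norm h) \<longlongrightarrow> 0) (at 0)"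
  proof (rule filterlim_cong[OF refl refl])
    show "\<forall>\<^sub>F h in at 0. norm ((f (x + h) - f x) /\<^sub>R h - D) = norm (f (x + h) - f x - h *\<^sub>R D) / norm h"
      unfolding eventually_at_filter
    proof (intro always_eventually allI impI)
      fix h :: real assume "h \<noteq> 0"
      then have "(f (x + h) - f x) /\<^sub>R h - D = (f (x + h) - f x - h *\<^sub>R D) /\<^sub>R h"
        by (simp add: scaleR_right_diff_distrib)
      then show "norm ((f (x + h) - f x) /\<^sub>R h - D) = norm (f (x + h) - f x - h *\<^sub>R D) / norm h"
        by (simp add: divide_inverse_commute)
    qed
  qed
  finally show ?thesis
    by (simp add: has_vector_derivative_def has_derivative_at bounded_linear_scaleR_left)
qed

text \<open>
  The mean value inequality bounds the difference quotients by the same \<open>w\<close> that bounds the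
  derivative, so dominated convergence applies to them. The bound is local
  because the derivative of the integrand of the Levy exponent grows with \<open>u\<close>.
\<close>

lemma has_vector_derivative_lebesgue_integral:
  fixes f :: "real \<Rightarrow> 'b \<Rightarrow> complex"
  assumes r: "0 < r"
    and int: "\<And>u. u \<in> ball u0 r \<Longrightarrow> integrable M (f u)"
    and meas [measurable]: "f' u0 \<in> borel_measurable M"
    and der: "\<And>u x. u \<in> ball u0 r \<Longrightarrow> x \<in> space M \<Longrightarrow> ((\<lambda>u. f u x) has_vector_derivative f' u x) (at u)"
    and bound: "\<And>u x. u \<in> ball u0 r \<Longrightarrow> x \<in> space M \<Longrightarrow> norm (f' u x) \<le> w x"
    and w: "integrable M w"
  shows "((\<lambda>u. LINT x|M. f u x) has_vector_derivative (LINT x|M. f' u0 x)) (at u0)"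
proof -
  have at0: "at (0::real) = at 0 within ball 0 r"
    by (rule at_within_open[symmetric]) (use r in auto)
  have u0: "u0 \<in> ball u0 r" using r by simp
  show ?thesis
    unfolding has_vector_derivative_at_iff_tendsto at0 tendsto_at_iff_sequentially
  proof (intro allI impI)
    fix h :: "nat \<Rightarrow> real"
    assume hr: "\<forall>i. h i \<in> ball 0 r - {0}" and h0: "h \<longlonglongrightarrow> 0"
    have hb: "u0 + h i \<in> ball u0 r" for i using hr by (auto simp: dist_norm)
    have im: "integrable M (f (u0 + h i))" for i by (rule int[OF hb])
    note [measurable] = borel_measurable_integrable[OF im] borel_measurable_integrable[OF int[OF u0]]
    have eq: "((\<lambda>h. ((LINT x|M. f (u0 + h) x) - (LINT x|M. f u0 x)) /\<^sub>R h) \<circ> h)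
        = (\<lambda>i. LINT x|M. (f (u0 + h i) x - f u0 x) /\<^sub>R h i)"
      using im int[OF u0] by (auto simp: fun_eq_iff)
    show "((\<lambda>h. ((LINT x|M. f (u0 + h) x) - (LINT x|M. f u0 x)) /\<^sub>R h) \<circ> h)
        \<longlonglongrightarrow> (LINT x|M. f' u0 x)"
      unfolding eq
    proof (rule integral_dominated_convergence[where w = w])
      show "AE x in M. (\<lambda>i. (f (u0 + h i) x - f u0 x) /\<^sub>R h i) \<longlonglongrightarrow> f' u0 x"
      proof (rule AE_I2)
        fix x assume "x \<in> space M"
        from der[OF u0 this] show "(\<lambda>i. (f (u0 + h i) x - f u0 x) /\<^sub>R h i) \<longlonglongrightarrow> f' u0 x"
          unfolding has_vector_derivative_at_iff_tendsto at0 tendsto_at_iff_sequentially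
          using hr h0 by (auto simp: o_def)
      qed
      show "AE x in M. norm ((f (u0 + h i) x - f u0 x) /\<^sub>R h i) \<le> w x" for i
      proof (rule AE_I2)
        fix x assume x: "x \<in> space M"
        have "norm (f (u0 + h i) x - f u0 x) \<le> w x * norm (u0 + h i - u0)"
        proof (rule differentiable_bound[OF _ _ _ hb u0])
          fix u assume "u \<in> ball u0 r"
          then show "((\<lambda>u. f u x) has_derivative (\<lambda>h. h *\<^sub>R f' u x)) (at u within ball u0 r)"
            "onorm (\<lambda>h. h *\<^sub>R f' u x) \<le> w x"
            using der[of u x] bound[of u x] x
            by (auto intro!: has_derivative_at_withinI onorm_le mult_left_mono
                simp: has_vector_derivative_def mult.commute[of "w x"])
        qed auto
        moreover have "h i \<noteq> 0" using hr by auto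
        ultimately show "norm ((f (u0 + h i) x - f u0 x) /\<^sub>R h i) \<le> w x"
          unfolding norm_scaleR by (simp add: field_simps)
      qed
    qed (use w in auto)
  qed
qed

lemma norm_iexp_minus_1: "norm (iexp y - 1) \<le> \<bar>y\<bar>"
  using iexp_approx1[of y 0] by simp

lemma norm_iexp_minus_linear: "norm (iexp y - 1 - \<i> * y) \<le> y\<^sup>2 / 2"
  using iexp_approx1[of y 1] by (simp add: diff_diff_eq power2_eq_square)

lemma has_vector_derivative_iexp_mult:
  "((\<lambda>u. iexp (u * x)) has_vector_derivative \<i> * x * iexp (u * x)) (at u)"
  by (rule has_vector_derivative_eq_rhs,
      rule field_vector_diff_chain_at[where g = exp and f = "\<lambda>u. \<i> * complex_of_real (u * x)", unfolded o_def])
    (auto intro!: derivative_eq_intros)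

text \<open>
  This is the \<open>m\<close>-th derivative of the Fourier transform of \<open>N\<close>, written so that it makes sense also
  for an infinite measure \<open>N\<close> for which the Fourier transform itself is undefined, as long as the
  \<open>m\<close>-th absolute moment is finite. Levy measures are of this kind for \<open>m \<ge> 2\<close>.
\<close>

definition fourier_moment :: "real measure \<Rightarrow> nat \<Rightarrow> real \<Rightarrow> complex" where
  "fourier_moment N m u = (LINT x|N. (\<i> * x) ^ m * iexp (u * x))"

lemma fourier_moment_0: "fourier_moment N 0 = char N"
  by (simp add: fourier_moment_def char_def fun_eq_iff)

lemma integrable_fourier_moment:
  assumes "sets N = sets borel" "integrable N (\<lambda>x. x ^ m)"
  shows "integrable N (\<lambda>x. (\<i> * x) ^ m * iexp (u * x))"
proof (rule Bochner_Integration.integrable_bound[OF assms(2)])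
  note [measurable_cong] = assms(1)
  show "(\<lambda>x. (\<i> * x) ^ m * iexp (u * x)) \<in> borel_measurable N" by measurable
qed (simp add: norm_mult norm_power power_abs)

lemma fourier_moment_at_0:
  "fourier_moment N m 0 = \<i> ^ m * complex_of_real (LINT x|N. x ^ m)"
  unfolding fourier_moment_def
  by (simp add: power_mult_distrib flip: of_real_power)

lemma has_vector_derivative_fourier_moment:
  assumes N: "sets N = sets borel"
    and m: "integrable N (\<lambda>x. x ^ m)" and Sm: "integrable N (\<lambda>x. x ^ Suc m)"
  shows "(fourier_moment N m has_vector_derivative fourier_moment N (Suc m) u) (at u)"
  unfolding fourier_moment_def
proof (rule has_vector_derivative_lebesgue_integral[OF zero_less_one])
  note [measurable_cong] = N
  show "(\<lambda>x. (\<i> * x) ^ Suc m * iexp (u * x)) \<in> borel_measurable N" by measurable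
  show "integrable N (\<lambda>x. \<bar>x ^ Suc m\<bar>)" using Sm by (rule integrable_abs)
  show "((\<lambda>u. (\<i> * x) ^ m * iexp (u * x)) has_vector_derivative (\<i> * x) ^ Suc m * iexp (v * x)) (at v)" for v x
    using has_vector_derivative_mult_right[OF has_vector_derivative_iexp_mult, of "(\<i> * x) ^ m" x v]
    by (simp add: mult_ac)
  show "norm ((\<i> * x) ^ Suc m * iexp (v * x)) \<le> \<bar>x ^ Suc m\<bar>" for v x
    by (simp add: norm_mult norm_power abs_mult power_abs)
qed (intro integrable_fourier_moment N m)

section \<open>Derivatives of exponentials and their first order behaviour\<close>

text \<open>
  If \<open>p j\<close> is the \<open>j\<close>-th derivative of a function \<open>p 0\<close>, then \<open>exp_deriv p t m\<close> is the \<open>m\<close>-th derivative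
  of \<open>exp (t * p 0)\<close>: the recursion is the Leibniz rule applied to the derivative
  \<open>t * p 1 * exp (t * p 0)\<close>. Listing the derivatives of \<open>p 0\<close> explicitly avoids iterating a derivative
  operator on functions that are differentiable only finitely often.
\<close>

fun exp_deriv :: "(nat \<Rightarrow> real \<Rightarrow> complex) \<Rightarrow> real \<Rightarrow> nat \<Rightarrow> real \<Rightarrow> complex" where
  "exp_deriv p t 0 u = exp (t * p 0 u)"
| "exp_deriv p t (Suc m) u = t * (\<Sum>j\<le>m. of_nat (m choose j) * (p (Suc j) u * exp_deriv p t (m - j) u))"

text \<open>
  Pascal's rule in the form in which it turns the derivative of a Leibniz sum into the next Leibniz sum.
\<close>

lemma sum_binomial_Suc:
  fixes a b :: "nat \<Rightarrow> 'a :: comm_semiring_1"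
  shows "(\<Sum>j\<le>Suc n. of_nat (Suc n choose j) * (a j * b (Suc n - j)))
    = (\<Sum>j\<le>n. of_nat (n choose j) * (a j * b (Suc (n - j)) + a (Suc j) * b (n - j)))"
proof -
  have "(\<Sum>j\<le>Suc n. of_nat (Suc n choose j) * (a j * b (Suc n - j)))
      = a 0 * b (Suc n) + (\<Sum>j\<le>n. of_nat (n choose Suc j) * (a (Suc j) * b (n - j)))
        + (\<Sum>j\<le>n. of_nat (n choose j) * (a (Suc j) * b (n - j)))"
    by (subst sum.atMost_Suc_shift) (simp add: sum.distrib algebra_simps)
  also have "a 0 * b (Suc n) + (\<Sum>j\<le>n. of_nat (n choose Suc j) * (a (Suc j) * b (n - j)))
      = (\<Sum>j\<le>Suc n. of_nat (n choose j) * (a j * b (Suc n - j)))"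
    by (subst sum.atMost_Suc_shift) simp
  also have "\<dots> = (\<Sum>j\<le>n. of_nat (n choose j) * (a j * b (Suc (n - j))))"
    by (simp add: Suc_diff_le binomial_eq_0)
  finally show ?thesis
    by (simp add: sum.distrib distrib_left)
qed

lemma has_vector_derivative_exp_deriv:
  assumes p: "\<And>j u. j < K \<Longrightarrow> (p j has_vector_derivative p (Suc j) u) (at u)"
    and "m < K"
  shows "(exp_deriv p t m has_vector_derivative exp_deriv p t (Suc m) u) (at u)"
  using \<open>m < K\<close>
proof (induction m rule: less_induct)
  case (less m)
  show ?case
  proof (cases m)
    case 0
    have "((exp \<circ> (\<lambda>u. t * p 0 u)) has_vector_derivative (t * p (Suc 0) u) * exp (t * p 0 u)) (at u)"
      using p[of 0 u] less.prems
      by (intro field_vector_diff_chain_at has_vector_derivative_mult_right DERIV_exp) auto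
    then show ?thesis
      using 0 by (simp add: o_def mult.assoc)
  next
    case (Suc n)
    have "((\<lambda>u. of_nat (n choose j) * (p (Suc j) u * exp_deriv p t (n - j) u)) has_vector_derivative
        of_nat (n choose j) * (p (Suc j) u * exp_deriv p t (Suc (n - j)) u
          + p (Suc (Suc j)) u * exp_deriv p t (n - j) u)) (at u)" if "j \<in> {..n}" for j
    proof -
      have "(p (Suc j) has_vector_derivative p (Suc (Suc j)) u) (at u)"
        using that Suc less.prems by (intro p) auto
      moreover have "(exp_deriv p t (n - j) has_vector_derivative exp_deriv p t (Suc (n - j)) u) (at u)"
        using that Suc less.prems by (intro less.IH) auto
      ultimately show ?thesis
        by (intro has_vector_derivative_mult_right has_vector_derivative_mult)
    qed
    then have "((\<lambda>u. t * (\<Sum>j\<le>n. of_nat (n choose j) * (p (Suc j) u * exp_deriv p t (n - j) u)))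
        has_vector_derivative t * (\<Sum>j\<le>n. of_nat (n choose j) * (p (Suc j) u * exp_deriv p t (Suc (n - j)) u
          + p (Suc (Suc j)) u * exp_deriv p t (n - j) u))) (at u)"
      by (rule has_vector_derivative_mult_right[OF has_vector_derivative_sum])
    also have "t * (\<Sum>j\<le>n. of_nat (n choose j) * (p (Suc j) u * exp_deriv p t (Suc (n - j)) u
          + p (Suc (Suc j)) u * exp_deriv p t (n - j) u)) = exp_deriv p t (Suc m) u"
      unfolding Suc by (subst exp_deriv.simps(2), subst sum_binomial_Suc) (rule refl)
    also have "(\<lambda>u. t * (\<Sum>j\<le>n. of_nat (n choose j) * (p (Suc j) u * exp_deriv p t (n - j) u)))
        = exp_deriv p t m"
      by (simp add: Suc fun_eq_iff)
    finally show ?thesis .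
  qed
qed

text \<open>
  Every term of \<open>exp_deriv p t (Suc m)\<close> carries a factor \<open>t\<close>. Apart from the leading term
  \<open>t * p (Suc m) * exp (t * p 0)\<close>, each one also contains a derivative of \<open>exp (t * p 0)\<close> of positive
  order, which by induction contributes a second factor \<open>t\<close>; and \<open>exp (t * p 0) - 1\<close> is \<open>O(t)\<close> as well.
  This is what makes moments of a Levy process at a small time \<open>t\<close> equal to \<open>t\<close> times the
  moments of its Levy measure, up to \<open>O(t\<^sup>2)\<close>.
\<close>

lemma exp_deriv_first_order:
  "\<exists>C\<ge>0. \<forall>t\<in>{0..1}. norm (exp_deriv p t (Suc m) u - t * p (Suc m) u) \<le> C * t\<^sup>2"
proof (induction m rule: less_induct)
  case (less m)
  have "\<exists>D\<ge>0. \<forall>t\<in>{0..1}. norm (exp_deriv p t (m - j) u) \<le> D * t" if j: "j < m" for j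
  proof -
    obtain k where k: "m - j = Suc k" "k < m" using j by (cases "m - j") auto
    obtain C where C: "C \<ge> 0" "\<And>t. t\<in>{0..1} \<Longrightarrow> norm (exp_deriv p t (m - j) u - t * p (m - j) u) \<le> C * t\<^sup>2"
      using less.IH[OF k(2)] unfolding k(1) by blast
    have "norm (exp_deriv p t (m - j) u) \<le> (C + norm (p (m - j) u)) * t" if t: "t \<in> {0..1}" for t
    proof -
      have "norm (exp_deriv p t (m - j) u)
          \<le> norm (exp_deriv p t (m - j) u - t * p (m - j) u) + norm (t * p (m - j) u)"
        by (simp add: norm_triangle_sub add.commute)
      also have "\<dots> \<le> C * t\<^sup>2 + t * norm (p (m - j) u)"
        using C(2)[OF t] t by (simp add: norm_mult)
      also have "\<dots> \<le> C * t + t * norm (p (m - j) u)"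
        using t C(1) by (simp add: power2_eq_square mult_left_mono mult_left_le_one_le)
      finally show ?thesis by (simp add: algebra_simps)
    qed
    with C(1) show ?thesis by (intro exI[of _ "C + norm (p (m - j) u)"]) auto
  qed
  then obtain D where D: "\<And>j. j < m \<Longrightarrow> D j \<ge> 0"
    "\<And>j t. j < m \<Longrightarrow> t \<in> {0..1} \<Longrightarrow> norm (exp_deriv p t (m - j) u) \<le> D j * t"
    by metis
  define A where "A = norm (p 0 u) * exp (norm (p 0 u))"
  have A: "norm (exp (t * p 0 u) - 1) \<le> A * t" if t: "t \<in> {0..1}" for t :: real
  proof -
    have "norm (exp (t * p 0 u) - 1) \<le> exp \<bar>Re (t * p 0 u)\<bar> * norm (t * p 0 u)"
      using Taylor_exp[of "t * p 0 u" 0] by simp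
    also have "\<dots> \<le> exp (norm (p 0 u)) * norm (t * p 0 u)"
    proof -
      have "\<bar>Re (t * p 0 u)\<bar> \<le> norm (t * p 0 u)" by (rule abs_Re_le_cmod)
      also have "\<dots> = t * norm (p 0 u)" using t by (simp add: norm_mult)
      also have "\<dots> \<le> 1 * norm (p 0 u)" using t by (intro mult_right_mono) auto
      finally show ?thesis by (simp add: mult_right_mono)
    qed
    finally show ?thesis using t by (simp add: A_def norm_mult mult_ac)
  qed
  define C where "C = norm (p (Suc m) u) * A + (\<Sum>j<m. real (m choose j) * (norm (p (Suc j) u) * D j))"
  have "norm (exp_deriv p t (Suc m) u - t * p (Suc m) u) \<le> C * t\<^sup>2" if t: "t \<in> {0..1}" for t
  proof -
    have "exp_deriv p t (Suc m) u - t * p (Suc m) u = t * (p (Suc m) u * (exp (t * p 0 u) - 1)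
        + (\<Sum>j<m. of_nat (m choose j) * (p (Suc j) u * exp_deriv p t (m - j) u)))"
      by (simp add: lessThan_Suc_atMost[symmetric] algebra_simps)
    also have "norm \<dots> = t * norm (p (Suc m) u * (exp (t * p 0 u) - 1)
        + (\<Sum>j<m. of_nat (m choose j) * (p (Suc j) u * exp_deriv p t (m - j) u)))"
      using t by (simp add: norm_mult)
    also have "\<dots> \<le> t * (norm (p (Suc m) u) * (A * t)
        + (\<Sum>j<m. real (m choose j) * (norm (p (Suc j) u) * (D j * t))))"
      using t A[OF t] D(2)[OF _ t]
      by (intro mult_left_mono norm_triangle_mono sum_norm_le)
        (auto simp: norm_mult intro!: mult_left_mono)
    also have "\<dots> = C * t\<^sup>2"
      by (simp add: C_def algebra_simps power2_eq_square sum_distrib_left)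
    finally show ?thesis .
  qed
  moreover have "C \<ge> 0"
    using D(1) by (auto simp: C_def A_def intro!: add_nonneg_nonneg sum_nonneg)
  ultimately show ?case by blast
qed

section \<open>Moments from smooth characteristic functions\<close>

lemma one_minus_cos_quotient_tendsto:
  "((\<lambda>h. (1 - cos (h * x)) / h\<^sup>2) \<longlongrightarrow> x\<^sup>2 / 2) (at (0::real))"
proof -
  have "((\<lambda>h. sin (h * x / 2)) has_real_derivative x / 2) (at 0)"
    by (auto intro!: derivative_eq_intros)
  then have "((\<lambda>h. sin (h * x / 2) / h) \<longlongrightarrow> x / 2) (at 0)"
    by (simp add: DERIV_def)
  then have "((\<lambda>h. 2 * (sin (h * x / 2) / h)\<^sup>2) \<longlongrightarrow> 2 * (x / 2)\<^sup>2) (at 0)"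
    by (rule tendsto_mult_left[OF tendsto_power])
  also have "(\<lambda>h. 2 * (sin (h * x / 2) / h)\<^sup>2) = (\<lambda>h. (1 - cos (h * x)) / h\<^sup>2)"
    using cos_double_sin[of "h * x / 2" for h] by (simp add: fun_eq_iff power_divide)
  finally show ?thesis by (simp add: power2_eq_square)
qed

text \<open>
  Write \<open>r h\<close> for the cosine transform of the measure with density \<open>w\<close>. It is maximal at \<open>0\<close>, so its
  derivative vanishes there and \<open>r 0 - r h\<close> is \<open>O(h\<^sup>2)\<close>. But \<open>(r 0 - r h) / h\<^sup>2\<close> is the integral of the
  nonnegative functions \<open>w x * (1 - cos (h * x)) / h\<^sup>2\<close>, which converge to \<open>w x * x\<^sup>2 / 2\<close>; so
  Fatou's lemma bounds the integral of the limit.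
\<close>

lemma integrable_square_of_twice_differentiable:
  fixes G :: "real measure" and w :: "real \<Rightarrow> real"
  assumes G: "sets G = sets borel"
    and w: "integrable G w" and w0: "\<And>x. 0 \<le> w x"
    and g: "\<And>h. ((\<lambda>h. LINT x|G. w x * cos (h * x)) has_real_derivative g h) (at h)"
    and g': "(g has_real_derivative g') (at 0)"
  shows "integrable G (\<lambda>x. x\<^sup>2 * w x)"
proof -
  note [measurable_cong] = G
  note [measurable] = borel_measurable_integrable[OF w]
  define r where "r h = (LINT x|G. w x * cos (h * x))" for h
  have int: "integrable G (\<lambda>x. w x * cos (h * x))" for h
  proof (rule Bochner_Integration.integrable_bound[OF w])
    show "AE x in G. norm (w x * cos (h * x)) \<le> norm (w x)"
      by (simp add: abs_mult mult_left_le)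
  qed simp
  have r0: "r 0 = (LINT x|G. w x)" by (simp add: r_def)
  have rh: "r 0 - r h = (LINT x|G. w x * (1 - cos (h * x)))" for h
    using int[of h] w by (simp add: r0 r_def right_diff_distrib)
  have r_le: "r h \<le> r 0" for h
  proof -
    have "0 \<le> r 0 - r h" unfolding rh using w0 by (intro Bochner_Integration.integral_nonneg) auto
    then show ?thesis by simp
  qed
  have dr: "(r has_real_derivative g h) (at h)" for h using g unfolding r_def .
  have "g 0 = 0" by (rule DERIV_local_max[OF dr zero_less_one]) (use r_le in auto)
  with g' have "((\<lambda>h. g h / h) \<longlongrightarrow> g') (at 0)" by (simp add: DERIV_def)
  then have "((\<lambda>h. \<bar>g h / h\<bar>) \<longlongrightarrow> \<bar>g'\<bar>) (at 0)" by (rule tendsto_rabs)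
  then have "\<forall>\<^sub>F h in at 0. \<bar>g h / h\<bar> < \<bar>g'\<bar> + 1" by (rule order_tendstoD) simp
  then obtain d where d: "d > 0" and gd: "\<And>h. h \<noteq> 0 \<Longrightarrow> \<bar>h\<bar> < d \<Longrightarrow> \<bar>g h / h\<bar> < \<bar>g'\<bar> + 1"
    by (auto simp: eventually_at dist_real_def)
  define C where "C = \<bar>g'\<bar> + 1"
  have quad: "r 0 - r h \<le> C * h\<^sup>2" if h: "0 < h" "h < d" for h
  proof -
    obtain z where z: "0 < z" "z < h" "r h - r 0 = (h - 0) * g z"
      using MVT2[OF h(1), of r g] dr by blast
    have "\<bar>g z\<bar> \<le> C * z" using gd[of z] z h by (simp add: C_def field_simps)
    also have "\<dots> \<le> C * h" using z by (intro mult_left_mono) (auto simp: C_def)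
    finally have "h * \<bar>g z\<bar> \<le> h * (C * h)" using h by (intro mult_left_mono) auto
    moreover have "r 0 - r h \<le> h * \<bar>g z\<bar>" using z h by (simp add: abs_if algebra_simps mult_left_mono)
    ultimately show ?thesis by (simp add: power2_eq_square mult_ac)
  qed
  \<comment> \<open>The shift by 2 keeps every \<open>h n\<close> strictly inside the interval where the quadratic bound holds.\<close>
  define h where "h n = d / real (n + 2)" for n
  have h: "0 < h n" "h n < d" for n using d by (auto simp: h_def field_simps intro!: add_pos_nonneg)
  have "(\<lambda>n. d / real (n + 2)) \<longlonglongrightarrow> 0"
    by (rule LIMSEQ_ignore_initial_segment[OF lim_const_over_n])
  then have h0: "filterlim h (at 0) sequentially"
    using h by (auto simp: filterlim_at h_def[abs_def] less_imp_neq)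
  define q where "q n x = w x * ((1 - cos (h n * x)) / (h n)\<^sup>2)" for n x
  have q_meas [measurable]: "q n \<in> borel_measurable G" for n unfolding q_def by measurable
  have q_int: "(\<integral>\<^sup>+x. q n x \<partial>G) \<le> ennreal C" for n
  proof -
    have i: "integrable G (\<lambda>x. w x * (1 - cos (h n * x)) / (h n)\<^sup>2)"
      using int[of "h n"] w by (simp add: right_diff_distrib)
    have "(\<integral>\<^sup>+x. q n x \<partial>G) = ennreal (LINT x|G. w x * (1 - cos (h n * x)) / (h n)\<^sup>2)"
      using i w0 unfolding q_def times_divide_eq_right
      by (intro nn_integral_eq_integral) auto
    also have "(LINT x|G. w x * (1 - cos (h n * x)) / (h n)\<^sup>2) = (r 0 - r (h n)) / (h n)\<^sup>2"
      by (simp add: rh)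
    also have "\<dots> \<le> C" using quad[OF h] h[of n] by (simp add: field_simps)
    finally show ?thesis by (simp add: ennreal_leI)
  qed
  have "(\<integral>\<^sup>+x. ennreal (w x * (x\<^sup>2 / 2)) \<partial>G) = (\<integral>\<^sup>+x. liminf (\<lambda>n. ennreal (q n x)) \<partial>G)"
  proof (rule nn_integral_cong)
    fix x
    have "(\<lambda>n. q n x) \<longlonglongrightarrow> w x * (x\<^sup>2 / 2)"
      unfolding q_def
      by (intro tendsto_mult_left filterlim_compose[OF one_minus_cos_quotient_tendsto h0])
    then have "(\<lambda>n. ennreal (q n x)) \<longlonglongrightarrow> ennreal (w x * (x\<^sup>2 / 2))"
      by (rule tendsto_ennrealI)
    then show "ennreal (w x * (x\<^sup>2 / 2)) = liminf (\<lambda>n. ennreal (q n x))"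
      by (metis lim_imp_Liminf sequentially_bot)
  qed
  also have "\<dots> \<le> liminf (\<lambda>n. \<integral>\<^sup>+x. q n x \<partial>G)"
    by (rule nn_integral_liminf) simp
  also have "\<dots> \<le> liminf (\<lambda>n. ennreal C)"
    by (rule Liminf_mono) (simp add: q_int)
  also have "\<dots> < \<infinity>" by (simp add: Liminf_const)
  finally have "integrable G (\<lambda>x. w x * (x\<^sup>2 / 2))"
    by (intro integrableI_nonneg) (auto simp: w0)
  then have "integrable G (\<lambda>x. 2 * (w x * (x\<^sup>2 / 2)))" by (rule integrable_mult_right)
  then show ?thesis by (simp add: mult.commute)
qed

text \<open>
  The converse of differentiation under the integral sign: a characteristic function that is
  \<open>2 * k\<close> times differentiable forces the moment of order \<open>2 * k\<close> to exist. Even orders are essential,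
  since positivity of \<open>x ^ (2 * k)\<close> is what Fatou's lemma uses; this is why the induction advances by two
  derivatives at a time. The derivatives \<open>F\<close> are then identified with moments by uniqueness.
\<close>

lemma moments_of_smooth_char:
  assumes P: "real_distribution P"
    and F0: "F 0 = char P"
    and F: "\<And>j u. j < 2 * k \<Longrightarrow> (F j has_vector_derivative F (Suc j) u) (at u)"
  shows "integrable P (\<lambda>x. x ^ (2 * k)) \<and> (\<forall>m\<le>2 * k. fourier_moment P m = F m)"
  using F
proof (induction k)
  case 0
  interpret P: real_distribution P by fact
  show ?case using F0 by (simp add: fourier_moment_0)
next
  case (Suc k)
  interpret P: real_distribution P by fact
  have IH: "integrable P (\<lambda>x. x ^ (2 * k))" "\<And>m. m \<le> 2 * k \<Longrightarrow> fourier_moment P m = F m"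
    using Suc by auto
  \<comment> \<open>The sign removes the factor \<open>\<i> ^ (2 * k)\<close>, so that \<open>s * F (2 * k)\<close> is the Fourier transform of a positive measure.\<close>
  define s :: complex where "s = (- 1) ^ k"
  have "Re (s * F (2 * k) h) = (LINT x|P. x ^ (2 * k) * cos (h * x))" for h
  proof -
    have "s * F (2 * k) h = (LINT x|P. s * ((\<i> * x) ^ (2 * k) * iexp (h * x)))"
      unfolding IH(2)[OF order_refl, symmetric] fourier_moment_def
      by (rule integral_mult_right_zero[symmetric])
    also have "\<dots> = (LINT x|P. x ^ (2 * k) * iexp (h * x))"
    proof (intro Bochner_Integration.integral_cong refl)
      fix x :: real
      have "s * ((\<i> * x)\<^sup>2) ^ k = (- 1 * (\<i> * x)\<^sup>2) ^ k"
        unfolding s_def by (rule power_mult_distrib[symmetric])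
      also have "- 1 * (\<i> * x)\<^sup>2 = complex_of_real (x\<^sup>2)" by (simp add: power_mult_distrib)
      finally show "s * ((\<i> * x) ^ (2 * k) * iexp (h * x)) = x ^ (2 * k) * iexp (h * x)"
        by (simp add: power_mult mult.assoc[symmetric])
    qed
    finally have "s * F (2 * k) h = (LINT x|P. x ^ (2 * k) * iexp (h * x))" .
    moreover have "integrable P (\<lambda>x. x ^ (2 * k) * iexp (h * x))"
      by (rule Bochner_Integration.integrable_bound[OF IH(1)]) (auto simp: norm_mult norm_power power_abs)
    ultimately show ?thesis
      by (simp add: Re_exp flip: integral_Re)
  qed
  then have eq: "(\<lambda>h. LINT x|P. x ^ (2 * k) * cos (h * x)) = (\<lambda>h. Re (s * F (2 * k) h))"
    by simp
  have dF: "((\<lambda>h. s * F j h) has_vector_derivative s * F (Suc j) h) (at h)"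
    if "j < 2 * Suc k" for j h
    using that by (intro has_vector_derivative_mult_right Suc.prems)
  have dRe: "((\<lambda>h. Re (s * F j h)) has_real_derivative Re (s * F (Suc j) h)) (at h)"
    if "j < 2 * Suc k" for j h
    using dF[OF that] by (simp only: has_vector_derivative_complex_iff)
  have "integrable P (\<lambda>x. x\<^sup>2 * x ^ (2 * k))"
  proof (rule integrable_square_of_twice_differentiable)
    show "((\<lambda>h. LINT x|P. x ^ (2 * k) * cos (h * x)) has_real_derivative Re (s * F (Suc (2 * k)) h)) (at h)" for h
      unfolding eq by (rule dRe) simp
    show "((\<lambda>h. Re (s * F (Suc (2 * k)) h)) has_real_derivative Re (s * F (Suc (Suc (2 * k))) 0)) (at 0)"
      by (rule dRe) simp
  qed (use IH in auto)
  then have i2: "integrable P (\<lambda>x. x ^ Suc (Suc (2 * k)))"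
    by (simp add: power2_eq_square mult_ac)
  have i1: "integrable P (\<lambda>x. x ^ Suc (2 * k))"
  proof (rule Bochner_Integration.integrable_bound)
    show "integrable P (\<lambda>x. x ^ (2 * k) + x ^ Suc (Suc (2 * k)))"
      using IH i2 by (intro Bochner_Integration.integrable_add)
    show "AE x in P. norm (x ^ Suc (2 * k)) \<le> norm (x ^ (2 * k) + x ^ Suc (Suc (2 * k)))"
    proof (rule AE_I2)
      fix x :: real
      have "\<bar>x\<bar> \<le> 1 + x\<^sup>2" using sum_power2_ge_zero[of "\<bar>x\<bar> - 1" "x"] by (simp add: power2_eq_square algebra_simps abs_if split: if_splits)
      then have "\<bar>x ^ (2 * k)\<bar> * \<bar>x\<bar> \<le> \<bar>x ^ (2 * k)\<bar> * (1 + x\<^sup>2)" by (rule mult_left_mono) simp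
      then show "norm (x ^ Suc (2 * k)) \<le> norm (x ^ (2 * k) + x ^ Suc (Suc (2 * k)))"
        by (simp add: abs_mult power2_eq_square algebra_simps)
    qed
  qed simp
  have step: "fourier_moment P (Suc m) = F (Suc m)"
    if "m < 2 * Suc k" "fourier_moment P m = F m" "integrable P (\<lambda>x. x ^ m)" "integrable P (\<lambda>x. x ^ Suc m)" for m
  proof
    fix u
    show "fourier_moment P (Suc m) u = F (Suc m) u"
      using has_vector_derivative_fourier_moment[OF P.events_eq_borel that(3,4), of u] Suc.prems[OF that(1), of u]
      unfolding that(2) by (rule vector_derivative_unique_at)
  qed
  have m1: "fourier_moment P (Suc (2 * k)) = F (Suc (2 * k))"
    by (rule step) (use IH i1 in auto)
  have m2: "fourier_moment P (Suc (Suc (2 * k))) = F (Suc (Suc (2 * k)))"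
    by (rule step) (use m1 i1 i2 in auto)
  show ?case
    using IH(2) m1 m2 i2 by (auto simp: le_Suc_eq)
qed

section \<open>The Levy exponent\<close>

definition levy_measure :: "(real \<Rightarrow> real) \<Rightarrow> real measure" where
  "levy_measure \<nu> = density lborel \<nu>"

text \<open>
  From order 2 on the compensating terms of the exponent have disappeared and the derivatives are Fourier
  transforms of powers against the Levy measure; the Gaussian part only contributes at orders
  up to 2.
\<close>

definition levy_exponent_deriv :: "real \<Rightarrow> real \<Rightarrow> (real \<Rightarrow> real) \<Rightarrow> nat \<Rightarrow> real \<Rightarrow> complex" where
  "levy_exponent_deriv b \<sigma> \<nu> m u =
     (if m = 0 then levy_exponent b \<sigma> \<nu> u
      else if m = 1 then \<i> * b - u * \<sigma>\<^sup>2 + (CLINT x|levy_measure \<nu>. \<i> * x * (iexp (u * x) - 1))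
      else fourier_moment (levy_measure \<nu>) m u - (if m = 2 then \<sigma>\<^sup>2 else 0))"

locale levy_density =
  fixes \<nu> :: "real \<Rightarrow> real"
  assumes density_measurable [measurable]: "\<nu> \<in> borel_measurable borel"
    and density_nonneg: "0 \<le> \<nu> x"
    and density_second_moment: "integrable lborel (\<lambda>x. x\<^sup>2 * \<nu> x)"
begin

abbreviation "N \<equiv> levy_measure \<nu>"

lemma sets_levy_measure [simp, measurable_cong]: "sets N = sets borel"
  by (simp add: levy_measure_def)

lemma integrable_levy_measure:
  fixes f :: "real \<Rightarrow> 'b :: {banach, second_countable_topology}"
  assumes [measurable]: "f \<in> borel_measurable borel"
  shows "integrable N f \<longleftrightarrow> integrable lborel (\<lambda>x. \<nu> x *\<^sub>R f x)"
  unfolding levy_measure_def by (rule integrable_density) (auto simp: density_nonneg)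

lemma integral_levy_measure:
  fixes f :: "real \<Rightarrow> 'b :: {banach, second_countable_topology}"
  assumes [measurable]: "f \<in> borel_measurable borel"
  shows "integral\<^sup>L N f = (LINT x|lborel. \<nu> x *\<^sub>R f x)"
  unfolding levy_measure_def by (rule integral_density) (auto simp: density_nonneg)

lemma levy_square_integrable: "integrable N (\<lambda>x. x\<^sup>2)"
  using density_second_moment by (subst integrable_levy_measure) (auto simp: mult.commute)

text \<open>
  The second moment controls small jumps and the moment of order \<open>p\<close> controls large ones.
\<close>

lemma levy_moment_integrable:
  assumes p: "integrable lborel (\<lambda>x. \<bar>x\<bar> powr p * \<nu> x)" and m: "2 \<le> m" "real m \<le> p"
  shows "integrable N (\<lambda>x. x ^ m)"
proof (rule Bochner_Integration.integrable_bound)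
  show "integrable N (\<lambda>x. x\<^sup>2 + \<bar>x\<bar> powr p)"
    using p by (intro Bochner_Integration.integrable_add levy_square_integrable)
      (subst integrable_levy_measure, auto simp: mult.commute)
  show "AE x in N. norm (x ^ m) \<le> norm (x\<^sup>2 + \<bar>x\<bar> powr p)"
  proof (rule AE_I2)
    fix x :: real
    consider "x = 0" | "0 < \<bar>x\<bar>" "\<bar>x\<bar> \<le> 1" | "1 \<le> \<bar>x\<bar>" by linarith
    then have "\<bar>x\<bar> ^ m \<le> x\<^sup>2 + \<bar>x\<bar> powr p"
    proof cases
      case 1 then show ?thesis using m by (simp add: power_0_left)
    next
      case 2
      have "\<bar>x\<bar> ^ m \<le> \<bar>x\<bar> ^ 2" using 2 m by (intro power_decreasing) auto
      then show ?thesis by (simp add: add_increasing2)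
    next
      case 3
      have "\<bar>x\<bar> ^ m = \<bar>x\<bar> powr real m" using 3 by (simp add: powr_realpow)
      also have "\<dots> \<le> \<bar>x\<bar> powr p" using 3 m by (intro powr_mono) auto
      finally show ?thesis by (simp add: add_increasing)
    qed
    then show "norm (x ^ m) \<le> norm (x\<^sup>2 + \<bar>x\<bar> powr p)" by (simp add: power_abs)
  qed
qed simp

lemma levy_exponent_eq:
  "levy_exponent b \<sigma> \<nu> u =
     \<i> * u * b - u\<^sup>2 * \<sigma>\<^sup>2 / 2 + (CLINT x|N. iexp (u * x) - 1 - \<i> * u * x)"
  unfolding levy_exponent_def
  by (subst integral_levy_measure) (auto simp: scaleR_conv_of_real mult.commute)

lemma integrable_levy_integrand: "integrable N (\<lambda>x. iexp (u * x) - 1 - \<i> * u * x)"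
proof (rule Bochner_Integration.integrable_bound)
  show "integrable N (\<lambda>x. u\<^sup>2 / 2 * x\<^sup>2)"
    by (intro integrable_mult_right levy_square_integrable)
  show "AE x in N. norm (iexp (u * x) - 1 - \<i> * u * x) \<le> norm (u\<^sup>2 / 2 * x\<^sup>2)"
    using norm_iexp_minus_linear[of "u * x" for x]
    by (intro AE_I2) (simp add: power_mult_distrib mult.assoc)
qed simp

lemma has_vector_derivative_levy_exponent_deriv:
  assumes K: "\<And>j. 2 \<le> j \<Longrightarrow> j \<le> K \<Longrightarrow> integrable N (\<lambda>x. x ^ j)" and m: "m < K"
  shows "(levy_exponent_deriv b \<sigma> \<nu> m has_vector_derivative levy_exponent_deriv b \<sigma> \<nu> (Suc m) u) (at u)"
proof -
  consider "m = 0" | "m = 1" | "m \<ge> 2" by linarith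
  then show ?thesis
  proof cases
    case 1
    have "((\<lambda>u. CLINT x|N. iexp (u * x) - 1 - \<i> * u * x) has_vector_derivative
        (CLINT x|N. \<i> * x * (iexp (u * x) - 1))) (at u)"
    proof (rule has_vector_derivative_lebesgue_integral[OF zero_less_one])
      show "integrable N (\<lambda>x. (\<bar>u\<bar> + 1) * x\<^sup>2)"
        by (intro integrable_mult_right levy_square_integrable)
      show "((\<lambda>u. iexp (u * x) - 1 - \<i> * u * x) has_vector_derivative \<i> * x * (iexp (v * x) - 1)) (at v)" for v x
      proof -
        have "((\<lambda>u. iexp (u * x) - 1 - \<i> * x * complex_of_real u) has_vector_derivative
            \<i> * x * iexp (v * x) - 0 - \<i> * x * complex_of_real 1) (at v)"
          by (intro has_vector_derivative_diff has_vector_derivative_iexp_mult has_vector_derivative_const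
              has_vector_derivative_mult_right has_vector_derivative_of_real[OF DERIV_ident])
        then show ?thesis by (simp add: algebra_simps)
      qed
      show "norm (\<i> * x * (iexp (v * x) - 1)) \<le> (\<bar>u\<bar> + 1) * x\<^sup>2" if v: "v \<in> ball u 1" for v x
      proof -
        have "norm (\<i> * x * (iexp (v * x) - 1)) \<le> \<bar>x\<bar> * \<bar>v * x\<bar>"
          using norm_iexp_minus_1[of "v * x"] by (simp add: norm_mult mult_left_mono)
        also have "\<dots> = \<bar>v\<bar> * x\<^sup>2" by (simp add: abs_mult power2_eq_square)
        also have "\<dots> \<le> (\<bar>u\<bar> + 1) * x\<^sup>2" using v by (intro mult_right_mono) (auto simp: dist_real_def)
        finally show ?thesis .
      qed
      show "integrable N (\<lambda>x. iexp (v * x) - 1 - \<i> * v * x)" for v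
        by (rule integrable_levy_integrand)
    qed simp
    moreover have "((\<lambda>u::real. \<i> * u * b - u\<^sup>2 * \<sigma>\<^sup>2 / 2) has_vector_derivative \<i> * b - u * \<sigma>\<^sup>2) (at u)"
      by (auto simp: has_vector_derivative_complex_iff power2_eq_square intro!: derivative_eq_intros)
    ultimately show ?thesis
      using 1 by (simp add: levy_exponent_deriv_def[abs_def] levy_exponent_eq[abs_def] has_vector_derivative_add)
  next
    case 2
    have "((\<lambda>u. CLINT x|N. \<i> * x * (iexp (u * x) - 1)) has_vector_derivative
        (CLINT x|N. (\<i> * x)\<^sup>2 * iexp (u * x))) (at u)"
    proof (rule has_vector_derivative_lebesgue_integral[OF zero_less_one _ _ _ _ levy_square_integrable])
      show "((\<lambda>u. \<i> * x * (iexp (u * x) - 1)) has_vector_derivative (\<i> * x)\<^sup>2 * iexp (v * x)) (at v)" for v x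
      proof -
        have "((\<lambda>u. \<i> * x * (iexp (u * x) - 1)) has_vector_derivative \<i> * x * (\<i> * x * iexp (v * x) - 0)) (at v)"
          by (intro has_vector_derivative_mult_right has_vector_derivative_diff has_vector_derivative_iexp_mult
              has_vector_derivative_const)
        then show ?thesis by (simp add: power2_eq_square mult.assoc)
      qed
      show "integrable N (\<lambda>x. \<i> * x * (iexp (v * x) - 1))" for v
      proof (rule Bochner_Integration.integrable_bound)
        show "integrable N (\<lambda>x. \<bar>v\<bar> * x\<^sup>2)"
          by (intro integrable_mult_right levy_square_integrable)
        show "AE x in N. norm (\<i> * x * (iexp (v * x) - 1)) \<le> norm (\<bar>v\<bar> * x\<^sup>2)"
        proof (rule AE_I2)
          fix x
          have "norm (\<i> * x * (iexp (v * x) - 1)) \<le> \<bar>x\<bar> * \<bar>v * x\<bar>"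
            using norm_iexp_minus_1[of "v * x"] by (simp add: norm_mult mult_left_mono)
          then show "norm (\<i> * x * (iexp (v * x) - 1)) \<le> norm (\<bar>v\<bar> * x\<^sup>2)"
            by (simp add: abs_mult power2_eq_square mult_ac)
        qed
      qed simp
    qed (auto simp: norm_mult norm_power)
    moreover have "((\<lambda>u::real. \<i> * b - u * \<sigma>\<^sup>2) has_vector_derivative - \<sigma>\<^sup>2) (at u)"
      by (auto simp: has_vector_derivative_complex_iff intro!: derivative_eq_intros)
    ultimately have "((\<lambda>u::real. \<i> * b - u * \<sigma>\<^sup>2 + (CLINT x|N. \<i> * x * (iexp (u * x) - 1)))
        has_vector_derivative - \<sigma>\<^sup>2 + (CLINT x|N. (\<i> * x)\<^sup>2 * iexp (u * x))) (at u)"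
      by (intro has_vector_derivative_add)
    moreover have "levy_exponent_deriv b \<sigma> \<nu> m
        = (\<lambda>u. \<i> * b - u * \<sigma>\<^sup>2 + (CLINT x|N. \<i> * x * (iexp (u * x) - 1)))"
      using 2 by (simp add: levy_exponent_deriv_def[abs_def])
    moreover have "levy_exponent_deriv b \<sigma> \<nu> (Suc m) u
        = - \<sigma>\<^sup>2 + (CLINT x|N. (\<i> * x)\<^sup>2 * iexp (u * x))"
      using 2 by (simp add: levy_exponent_deriv_def fourier_moment_def numeral_2_eq_2)
    ultimately show ?thesis by simp
  next
    case 3
    have "(fourier_moment N m has_vector_derivative fourier_moment N (Suc m) u) (at u)"
      using 3 m by (intro has_vector_derivative_fourier_moment K) auto
    then show ?thesis
      using 3 by (simp add: levy_exponent_deriv_def[abs_def] has_vector_derivative_diff_const)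
  qed
qed

lemma levy_exponent_deriv_at_0:
  assumes "2 \<le> l"
  shows "levy_exponent_deriv b \<sigma> \<nu> l 0 = \<i> ^ l * c_lim \<sigma> \<nu> l"
proof -
  have "(LINT x|N. x ^ l) = (LINT x|lborel. x ^ l * \<nu> x)"
    by (subst integral_levy_measure) (auto simp: mult.commute)
  then show ?thesis
    using assms by (auto simp: levy_exponent_deriv_def fourier_moment_at_0 c_lim_def algebra_simps)
qed

text \<open>
  The exponent vanishes to first order at \<open>0\<close> except for its drift, and its second derivative there is
  \<open>- c_lim \<sigma> \<nu> 2\<close>. Dominated convergence with the bound \<open>u\<^sup>2 * x\<^sup>2 / 2\<close> turns this into the Gaussian
  exponent.
\<close>

lemma levy_exponent_rescaled_limit:
  fixes T :: "nat \<Rightarrow> real"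
  assumes T0: "\<And>n. 0 \<le> T n" and T: "filterlim T at_top sequentially"
  shows "(\<lambda>n. T n * levy_exponent b \<sigma> \<nu> (u / sqrt (T n)) - \<i> * u * (sqrt (T n) * b))
    \<longlonglongrightarrow> complex_of_real (- (c_lim \<sigma> \<nu> 2 * u\<^sup>2 / 2))"
proof -
  define R :: "real \<Rightarrow> complex" where "R y = iexp y - 1 - \<i> * y" for y
  define h where "h n = u / sqrt (T n)" for n
  have h2: "T n * (h n)\<^sup>2 \<le> u\<^sup>2" for n
    using T0[of n] by (simp add: h_def power_divide)
  have "(\<lambda>n. CLINT x|N. T n * R (h n * x)) \<longlonglongrightarrow> (CLINT x|N. complex_of_real (- (u * x)\<^sup>2 / 2))"
  proof (rule integral_dominated_convergence)
    show "(\<lambda>x. T n * R (h n * x)) \<in> borel_measurable N" for n unfolding R_def by measurable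
    show "(\<lambda>x. complex_of_real (- (u * x)\<^sup>2 / 2)) \<in> borel_measurable N" by measurable
    show "integrable N (\<lambda>x. u\<^sup>2 / 2 * x\<^sup>2)"
      by (intro integrable_mult_right levy_square_integrable)
    show "AE x in N. norm (T n * R (h n * x)) \<le> u\<^sup>2 / 2 * x\<^sup>2" for n
    proof (rule AE_I2)
      fix x
      have "norm (T n * R (h n * x)) \<le> T n * ((h n * x)\<^sup>2 / 2)"
        using mult_left_mono[OF norm_iexp_minus_linear[of "h n * x"] T0[of n]] T0[of n]
        unfolding R_def norm_mult by simp
      also have "\<dots> = T n * (h n)\<^sup>2 * (x\<^sup>2 / 2)" by (simp add: power_mult_distrib)
      also have "\<dots> \<le> u\<^sup>2 * (x\<^sup>2 / 2)" by (intro mult_right_mono h2) auto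
      finally show "norm (T n * R (h n * x)) \<le> u\<^sup>2 / 2 * x\<^sup>2" by simp
    qed
    show "AE x in N. (\<lambda>n. T n * R (h n * x)) \<longlonglongrightarrow> complex_of_real (- (u * x)\<^sup>2 / 2)"
    proof (rule AE_I2)
      fix x
      have "\<forall>\<^sub>F n in sequentially. norm (T n * R (h n * x) - complex_of_real (- (u * x)\<^sup>2 / 2))
          \<le> \<bar>u * x\<bar> ^ 3 / 6 / sqrt (T n)"
        using filterlim_at_top_dense[THEN iffD1, OF T, rule_format, of 0]
      proof eventually_elim
        case (elim n)
        define y where "y = h n * x"
        have Ty: "T n * y\<^sup>2 = (u * x)\<^sup>2"
          using elim by (simp add: y_def h_def power_mult_distrib power_divide)
        have "norm (R y + y\<^sup>2 / 2) \<le> \<bar>y\<bar> ^ 3 / 6"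
          using iexp_approx1[of y 2]
          by (simp add: R_def numeral_2_eq_2 numeral_3_eq_3 power_mult_distrib algebra_simps)
        then have "T n * norm (R y + y\<^sup>2 / 2) \<le> T n * (\<bar>y\<bar> ^ 3 / 6)"
          using elim by (intro mult_left_mono) auto
        also have "T n * norm (R y + y\<^sup>2 / 2) = norm (T n * R y + complex_of_real (T n * y\<^sup>2) / 2)"
        proof -
          have "T n * R y + complex_of_real (T n * y\<^sup>2) / 2 = complex_of_real (T n) * (R y + y\<^sup>2 / 2)"
            by (simp add: distrib_left)
          then show ?thesis using elim by (simp only: norm_mult norm_of_real abs_of_pos)
        qed
        also have "T n * (\<bar>y\<bar> ^ 3 / 6) = (T n * y\<^sup>2) * \<bar>y\<bar> / 6"
          by (simp add: power3_eq_cube power2_eq_square abs_mult[symmetric] mult.assoc)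
        also have "\<dots> = \<bar>u * x\<bar> ^ 3 / 6 / sqrt (T n)"
          unfolding Ty using elim by (simp add: y_def h_def power3_eq_cube power2_eq_square abs_mult)
        finally show ?case unfolding Ty by (simp add: y_def)
      qed
      moreover have "(\<lambda>n. \<bar>u * x\<bar> ^ 3 / 6 / sqrt (T n)) \<longlonglongrightarrow> 0"
        by (intro tendsto_divide_0[OF tendsto_const] filterlim_at_top_imp_at_infinity
            filterlim_compose[OF sqrt_at_top T])
      ultimately have "(\<lambda>n. T n * R (h n * x) - complex_of_real (- (u * x)\<^sup>2 / 2)) \<longlonglongrightarrow> 0"
        by (rule Lim_null_comparison)
      then show "(\<lambda>n. T n * R (h n * x)) \<longlonglongrightarrow> complex_of_real (- (u * x)\<^sup>2 / 2)"
        by (rule LIM_zero_cancel)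
    qed
  qed
  also have "(CLINT x|N. complex_of_real (- (u * x)\<^sup>2 / 2)) = complex_of_real (LINT x|N. - (u * x)\<^sup>2 / 2)"
    by (rule integral_complex_of_real)
  also have "(LINT x|N. - (u * x)\<^sup>2 / 2) = - (LINT x|N. x\<^sup>2) * u\<^sup>2 / 2"
    by (simp add: power_mult_distrib mult.commute)
  finally have "(\<lambda>n. - complex_of_real (u\<^sup>2 * \<sigma>\<^sup>2 / 2) + (CLINT x|N. T n * R (h n * x)))
      \<longlonglongrightarrow> - complex_of_real (u\<^sup>2 * \<sigma>\<^sup>2 / 2) + complex_of_real (- (LINT x|N. x\<^sup>2) * u\<^sup>2 / 2)"
    by (intro tendsto_intros)
  also have "- complex_of_real (u\<^sup>2 * \<sigma>\<^sup>2 / 2) + complex_of_real (- (LINT x|N. x\<^sup>2) * u\<^sup>2 / 2)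
      = complex_of_real (- (c_lim \<sigma> \<nu> 2 * u\<^sup>2 / 2))"
  proof -
    have "(LINT x|N. x\<^sup>2) = (LINT x|lborel. x\<^sup>2 * \<nu> x)"
      by (subst integral_levy_measure) (auto simp: mult.commute)
    then show ?thesis by (simp add: c_lim_def algebra_simps add_divide_distrib)
  qed
  finally show ?thesis
  proof (rule Lim_transform_eventually)
    show "\<forall>\<^sub>F n in sequentially. - complex_of_real (u\<^sup>2 * \<sigma>\<^sup>2 / 2) + (CLINT x|N. T n * R (h n * x))
        = T n * levy_exponent b \<sigma> \<nu> (u / sqrt (T n)) - \<i> * u * (sqrt (T n) * b)"
      using filterlim_at_top_dense[THEN iffD1, OF T, rule_format, of 0]
    proof eventually_elim
      case (elim n)
      have "T n * h n = u * sqrt (T n)"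
        using elim by (simp add: h_def real_div_sqrt field_simps)
      moreover have "T n * (h n)\<^sup>2 = u\<^sup>2" using elim by (simp add: h_def power_divide)
      ultimately have "complex_of_real (T n) * h n = u * sqrt (T n)" "complex_of_real (T n) * (h n)\<^sup>2 = u\<^sup>2"
        by (metis of_real_mult, metis of_real_mult of_real_power)
      note hT = this
      define I where "I = (CLINT x|N. R (h n * x))"
      have "levy_exponent b \<sigma> \<nu> (h n) = \<i> * h n * b - (complex_of_real (h n))\<^sup>2 * \<sigma>\<^sup>2 / 2 + I"
        by (simp add: levy_exponent_eq I_def R_def mult.assoc)
      then have "T n * levy_exponent b \<sigma> \<nu> (h n)
          = \<i> * (complex_of_real (T n) * h n) * b - (complex_of_real (T n) * (h n)\<^sup>2) * \<sigma>\<^sup>2 / 2 + T n * I"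
        by (simp add: distrib_left right_diff_distrib mult.assoc mult.left_commute)
      then have "T n * levy_exponent b \<sigma> \<nu> (h n) = \<i> * (u * sqrt (T n)) * b - u\<^sup>2 * \<sigma>\<^sup>2 / 2 + T n * I"
        unfolding hT by simp
      then show ?case by (simp add: h_def I_def mult.assoc)
    qed
  qed
qed

end

section \<open>Normal limits and weak convergence of finite measures\<close>

text \<open>
  For \<open>v = 0\<close> the law is a point mass, whose characteristic function agrees with the same formula.
\<close>

lemma normal_law_char:
  assumes "0 \<le> v"
  shows "char (normal_law 0 v) u = exp (- (v * u\<^sup>2 / 2))"
proof (cases "v = 0")
  case True
  then show ?thesis by (simp add: normal_law_def char_def integral_return)
next
  case False
  interpret S: prob_space std_normal_distribution by (rule prob_space_normal_density) simp
  have "distributed std_normal_distribution lborel (\<lambda>x. x) std_normal_density"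
    by (auto simp: distributed_def distr_id2)
  from S.normal_density_affine[OF this, of "sqrt v" 0]
  have "distr std_normal_distribution lborel (\<lambda>x. sqrt v * x) = density lborel (normal_density 0 (sqrt v))"
    using assms False by (simp add: distributed_def)
  then have "char (normal_law 0 v) u = (CLINT x|distr std_normal_distribution lborel (\<lambda>x. sqrt v * x). iexp (u * x))"
    using False by (simp add: normal_law_def char_def)
  also have "\<dots> = char std_normal_distribution (u * sqrt v)"
    by (subst integral_distr) (auto simp: char_def mult.assoc)
  also have "\<dots> = exp (- (v * u\<^sup>2 / 2))"
    using assms by (simp add: char_std_normal_distribution power_mult_distrib mult.commute)
  finally show ?thesis .
qed

lemma real_distribution_normal_law:
  assumes "0 \<le> v"
  shows "real_distribution (normal_law m v)"
  using assms prob_space_normal_density[of "sqrt v" m]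
  by (auto simp: normal_law_def real_distribution_def real_distribution_axioms_def prob_space_return)

text \<open>
  Lindeberg's central limit theorem for rows of \<open>n\<close> independent variables with common law \<open>P n\<close>, stated for
  characteristic functions only, so that independence enters later. The means are merely asymptotically
  negligible rather than zero. The Lindeberg condition is expressed through
  \<open>min (x\<^sup>2) (\<bar>x\<bar> ^ 3)\<close>, which bounds the remainder in the second order expansion of \<open>exp (\<i> * u * x)\<close>
  up to a constant depending on \<open>u\<close>.
\<close>

lemma char_power_tendsto_normal:
  fixes P :: "nat \<Rightarrow> real measure"
  assumes P: "\<And>n. real_distribution (P n)"
    and sq: "\<And>n. integrable (P n) (\<lambda>x. x\<^sup>2)"
    and mean: "(\<lambda>n. real n * (LINT x|P n. x)) \<longlonglongrightarrow> 0"
    and var: "(\<lambda>n. real n * (LINT x|P n. x\<^sup>2)) \<longlonglongrightarrow> v"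
    and lind: "(\<lambda>n. real n * (LINT x|P n. min (x\<^sup>2) (\<bar>x\<bar> ^ 3))) \<longlonglongrightarrow> 0"
  shows "(\<lambda>n. char (P n) u ^ n) \<longlonglongrightarrow> exp (- (v * u\<^sup>2 / 2))"
proof -
  have v: "0 \<le> v"
    by (rule LIMSEQ_le_const[OF var]) (auto intro!: exI[of _ 0] mult_nonneg_nonneg)
  define s where "s = v * u\<^sup>2 / 2"
  define q where "q n = 1 + \<i> * u * (LINT x|P n. x) - u\<^sup>2 / 2 * (LINT x|P n. x\<^sup>2)" for n
  define B where "B n = (LINT x|P n. min (x\<^sup>2) (\<bar>x\<bar> ^ 3))" for n
  define C where "C = u\<^sup>2 / 6 * (6 + \<bar>u\<bar>)"
  have taylor: "norm (char (P n) u - q n) \<le> C * B n" for n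
  proof -
    interpret Q: real_distribution "P n" by (rule P)
    have int1: "integrable (P n) (\<lambda>x. x)"
      by (rule Q.square_integrable_imp_integrable[OF _ sq]) simp
    have mom: "integrable (P n) (\<lambda>x. x ^ k)" if "k \<le> 2" for k
      using that int1 sq[of n] by (auto simp: le_Suc_eq numeral_2_eq_2)
    have b3: "integrable (P n) (\<lambda>x. min (x\<^sup>2) (\<bar>x\<bar> ^ 3))"
      by (rule Bochner_Integration.integrable_bound[OF sq[of n]]) auto
    have b6: "integrable (P n) (\<lambda>x. min (2 * \<bar>x\<bar>\<^sup>2 * real (Suc 2)) (\<bar>u\<bar> * \<bar>x\<bar> ^ Suc 2))"
      by (rule Bochner_Integration.integrable_bound[OF integrable_mult_right[OF sq[of n], of 6]]) auto
    have "norm (char (P n) u - q n)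
        = norm (char (P n) u - (\<Sum>k\<le>2. (\<i> * u) ^ k / fact k * Q.expectation (\<lambda>x. x ^ k)))"
      using Q.prob_space by (simp add: q_def numeral_2_eq_2 power_mult_distrib algebra_simps)
    also have "\<dots> \<le> \<bar>u\<bar>\<^sup>2 / fact (Suc 2) *
        (LINT x|P n. min (2 * \<bar>x\<bar>\<^sup>2 * real (Suc 2)) (\<bar>u\<bar> * \<bar>x\<bar> ^ Suc 2))"
      by (rule Q.char_approx2[OF mom])
    also have "\<dots> \<le> \<bar>u\<bar>\<^sup>2 / fact (Suc 2) * (LINT x|P n. (6 + \<bar>u\<bar>) * min (x\<^sup>2) (\<bar>x\<bar> ^ 3))"
    proof (rule mult_left_mono[OF integral_mono[OF b6 integrable_mult_right[OF b3]]])
      fix x :: real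
      have "6 * x\<^sup>2 \<le> (6 + \<bar>u\<bar>) * x\<^sup>2" "\<bar>u\<bar> * \<bar>x\<bar> ^ 3 \<le> (6 + \<bar>u\<bar>) * \<bar>x\<bar> ^ 3"
        by (intro mult_right_mono; simp)+
      then have "min (6 * x\<^sup>2) (\<bar>u\<bar> * \<bar>x\<bar> ^ 3) \<le> min ((6 + \<bar>u\<bar>) * x\<^sup>2) ((6 + \<bar>u\<bar>) * \<bar>x\<bar> ^ 3)"
        by (rule min.mono)
      also have "\<dots> = (6 + \<bar>u\<bar>) * min (x\<^sup>2) (\<bar>x\<bar> ^ 3)"
        by (rule mult_min_right[symmetric]) simp
      finally show "min (2 * \<bar>x\<bar>\<^sup>2 * real (Suc 2)) (\<bar>u\<bar> * \<bar>x\<bar> ^ Suc 2) \<le> (6 + \<bar>u\<bar>) * min (x\<^sup>2) (\<bar>x\<bar> ^ 3)"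
        by simp
    qed simp
    finally show ?thesis
      by (simp add: C_def B_def fact_numeral mult_ac)
  qed
  have "(\<lambda>n. real n * (C * B n)) \<longlonglongrightarrow> 0"
    using tendsto_mult_right_zero[OF lind, of C] by (simp add: B_def mult_ac)
  moreover have "norm (real n * (char (P n) u - q n)) \<le> real n * (C * B n)" for n
    using taylor[of n] by (simp add: norm_mult mult_left_mono)
  ultimately have 1: "(\<lambda>n. real n * (char (P n) u - q n)) \<longlonglongrightarrow> 0"
    by (rule Lim_null_comparison[OF always_eventually[OF allI], rotated])
  have "(\<lambda>n. \<i> * u * complex_of_real (real n * (LINT x|P n. x)) - u\<^sup>2 / 2 * complex_of_real (real n * (LINT x|P n. x\<^sup>2)))
      \<longlonglongrightarrow> \<i> * u * complex_of_real 0 - u\<^sup>2 / 2 * complex_of_real v"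
    by (intro tendsto_intros mean var)
  then have 2: "(\<lambda>n. real n * (q n - 1)) \<longlonglongrightarrow> - complex_of_real s"
    by (simp add: q_def s_def algebra_simps)
  have "(\<lambda>n. real n * (char (P n) u - q n) + real n * (q n - 1)) \<longlonglongrightarrow> 0 + (- complex_of_real s)"
    by (intro tendsto_add 1 2)
  then have "(\<lambda>n. real n * (char (P n) u - 1)) \<longlonglongrightarrow> - complex_of_real s"
    by (simp add: algebra_simps)
  then have 3: "(\<lambda>n. norm (real n * (char (P n) u - 1) + complex_of_real s)) \<longlonglongrightarrow> 0"
    using tendsto_norm_zero[OF LIM_zero[of _ "- complex_of_real s"]] by fastforce
  have "\<forall>\<^sub>F n in sequentially. norm (char (P n) u ^ n - complex_of_real ((1 + (- s) / real n) ^ n))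
      \<le> norm (real n * (char (P n) u - 1) + complex_of_real s)"
    using eventually_gt_at_top[of "0::nat"] eventually_ge_at_top[of "nat \<lceil>s\<rceil>"]
  proof eventually_elim
    case (elim n)
    interpret Q: real_distribution "P n" by (rule P)
    have sn: "s \<le> real n" using elim by linarith
    have s0: "0 \<le> s" using v by (simp add: s_def)
    have "norm (char (P n) u ^ n - complex_of_real (1 + (- s) / real n) ^ n)
        \<le> real n * norm (char (P n) u - complex_of_real (1 + (- s) / real n))"
    proof (rule norm_power_diff[OF Q.cmod_char_le_1])
      have "0 \<le> 1 + (- s) / real n" "1 + (- s) / real n \<le> 1"
        using sn s0 elim by (auto simp: field_simps)
      then show "norm (complex_of_real (1 + (- s) / real n)) \<le> 1"
        unfolding norm_of_real by linarith
    qed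
    also have "\<dots> = norm (real n * (char (P n) u - complex_of_real (1 + (- s) / real n)))"
      by (simp add: norm_mult)
    also have "real n * (char (P n) u - complex_of_real (1 + (- s) / real n))
        = real n * (char (P n) u - 1) + complex_of_real s"
      using elim by (simp add: field_simps)
    finally show ?case by simp
  qed
  from Lim_null_comparison[OF this 3]
  have "(\<lambda>n. char (P n) u ^ n - complex_of_real ((1 + (- s) / real n) ^ n)) \<longlonglongrightarrow> 0" .
  moreover have "(\<lambda>n. complex_of_real ((1 + (- s) / real n) ^ n)) \<longlonglongrightarrow> complex_of_real (exp (- s))"
    by (intro tendsto_of_real tendsto_exp_limit_sequentially)
  ultimately show ?thesis
    using Lim_transform by (fastforce simp: s_def)
qed

text \<open>
  Levy's continuity theorem for finite measures: dividing by the total masses, which are the values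
  of the transforms at \<open>0\<close>, reduces it to probability measures. A limit of total mass zero cannot be
  normalised and is treated directly.
\<close>

lemma integral_tendsto_of_char_tendsto:
  fixes H :: "nat \<Rightarrow> real measure" and H' :: "real measure" and f :: "real \<Rightarrow> real"
  assumes fin: "\<And>n. finite_measure (H n)" "finite_measure H'"
    and sets: "\<And>n. sets (H n) = sets borel" "sets H' = sets borel"
    and char: "\<And>u. (\<lambda>n. char (H n) u) \<longlonglongrightarrow> char H' u"
    and f: "\<And>x. isCont f x" "\<And>x. \<bar>f x\<bar> \<le> B"
  shows "(\<lambda>n. LINT x|H n. f x) \<longlonglongrightarrow> (LINT x|H'. f x)"
proof -
  have f_borel [measurable]: "f \<in> borel_measurable borel"
    using f(1) by (intro borel_measurable_continuous_onI continuous_at_imp_continuous_on) auto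
  define mass where "mass G = measure G UNIV" for G :: "real measure"
  have char0: "char G 0 = complex_of_real (mass G)" if "sets G = sets borel" for G
    using sets_eq_imp_space_eq[OF that] by (simp add: char_def mass_def scaleR_conv_of_real)
  have mass_lim: "(\<lambda>n. mass (H n)) \<longlonglongrightarrow> mass H'"
    using char[of 0] sets by (simp add: char0 tendsto_of_real_iff)
  have bound: "\<bar>LINT x|G. f x\<bar> \<le> B * mass G" if "finite_measure G" "sets G = sets borel" for G
  proof -
    interpret finite_measure G by fact
    note [measurable_cong] = that(2)
    have "\<bar>LINT x|G. f x\<bar> \<le> (LINT x|G. \<bar>f x\<bar>)" by (rule integral_abs_bound)
    also have "\<dots> \<le> (LINT x|G. B)"
      using f(2) by (intro integral_mono integrable_const integrable_const_bound[of _ B]) auto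
    finally show ?thesis
      using sets_eq_imp_space_eq[OF that(2)] by (simp add: mass_def mult.commute)
  qed
  show ?thesis
  proof (cases "mass H' = 0")
    case True
    have "(LINT x|H'. f x) = 0" using bound[OF fin(2) sets(2)] True by simp
    moreover have "(\<lambda>n. B * mass (H n)) \<longlonglongrightarrow> 0"
      using tendsto_mult_left[OF mass_lim, of B] True by simp
    then have "(\<lambda>n. LINT x|H n. f x) \<longlonglongrightarrow> 0"
      by (rule Lim_null_comparison[rotated]) (simp add: bound fin sets)
    ultimately show ?thesis by simp
  next
    case False
    define nrm where "nrm G = (if mass G = 0 then return borel 0 else density G (\<lambda>_. 1 / mass G))"
      for G :: "real measure"
    have nrm: "real_distribution (nrm G)" if "finite_measure G" "sets G = sets borel" for G
    proof (cases "mass G = 0")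
      case True
      then show ?thesis
        by (auto simp: nrm_def real_distribution_def real_distribution_axioms_def prob_space_return)
    next
      case False
      interpret finite_measure G by fact
      have sp: "space G = UNIV" using sets_eq_imp_space_eq[OF that(2)] by simp
      have m: "0 < mass G" using False by (simp add: mass_def zero_less_measure_iff order_less_le)
      have "emeasure (density G (\<lambda>_. ennreal (1 / mass G))) UNIV = ennreal (1 / mass G) * emeasure G UNIV"
        using sp sets.top[of G] by (subst emeasure_density_const) auto
      also have "\<dots> = 1"
        using m by (simp add: emeasure_eq_measure mass_def ennreal_mult[symmetric])
      finally show ?thesis
        using False that sp by (auto simp: nrm_def real_distribution_def real_distribution_axioms_def
            intro!: prob_spaceI)
    qed
    have nrm_int: "(LINT x|nrm G. g x) = (LINT x|G. g x) /\<^sub>R mass G"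
      if "mass G \<noteq> 0" "sets G = sets borel" "g \<in> borel_measurable borel"
      for G and g :: "real \<Rightarrow> 'b :: {banach, second_countable_topology}"
    proof -
      note [measurable_cong] = that(2)
      note [measurable] = that(3)
      show ?thesis
        using that(1) by (simp add: nrm_def integral_density mass_def divide_inverse)
    qed
    have ev: "\<forall>\<^sub>F n in sequentially. mass (H n) \<noteq> 0"
      using tendsto_imp_eventually_ne[OF mass_lim False] .
    have wc: "weak_conv_m (\<lambda>n. nrm (H n)) (nrm H')"
    proof (rule levy_continuity)
      fix u
      have "(\<lambda>n. char (H n) u /\<^sub>R mass (H n)) \<longlonglongrightarrow> char H' u /\<^sub>R mass H'"
        by (intro tendsto_intros char mass_lim False)
      moreover have "char (nrm H') u = char H' u /\<^sub>R mass H'"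
        unfolding char_def by (rule nrm_int) (auto simp: False sets)
      moreover have "\<forall>\<^sub>F n in sequentially. char (H n) u /\<^sub>R mass (H n) = char (nrm (H n)) u"
        using ev unfolding char_def by eventually_elim (rule nrm_int[symmetric], auto simp: sets)
      ultimately show "(\<lambda>n. char (nrm (H n)) u) \<longlonglongrightarrow> char (nrm H') u"
        using Lim_transform_eventually by force
    qed (rule nrm[OF fin(1) sets(1)], rule nrm[OF fin(2) sets(2)])
    have "(\<lambda>n. mass (H n) * (LINT x|nrm (H n). f x)) \<longlonglongrightarrow> mass H' * (LINT x|nrm H'. f x)"
      using f by (intro tendsto_mult mass_lim
          weak_conv_imp_integral_bdd_continuous_conv[OF nrm[OF fin(1) sets(1)] nrm[OF fin(2) sets(2)] wc]) auto
    moreover have "mass H' * (LINT x|nrm H'. f x) = (LINT x|H'. f x)"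
      using False by (subst nrm_int) (auto simp: sets)
    moreover have "\<forall>\<^sub>F n in sequentially. mass (H n) * (LINT x|nrm (H n). f x) = (LINT x|H n. f x)"
      using ev by eventually_elim (subst nrm_int, auto simp: sets)
    ultimately show ?thesis
      using Lim_transform_eventually by force
  qed
qed

text \<open>
  Weakly convergent finite measures are tight: once \<open>R n\<close> exceeds a fixed \<open>K\<close>, the integrand is dominated by
  the bounded continuous function \<open>min 1 (\<bar>x\<bar> ^ l / K)\<close>, whose integrals converge to a limit that is
  small if \<open>K\<close> is large.
\<close>

lemma integral_min_power_tendsto_0:
  fixes H :: "nat \<Rightarrow> real measure" and H' :: "real measure"
  assumes fin: "\<And>n. finite_measure (H n)" "finite_measure H'"
    and sets: "\<And>n. sets (H n) = sets borel" "sets H' = sets borel"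
    and char: "\<And>u. (\<lambda>n. char (H n) u) \<longlonglongrightarrow> char H' u"
    and R: "filterlim R at_top sequentially"
  shows "(\<lambda>n. LINT x|H n. min 1 (\<bar>x\<bar> ^ l / R n)) \<longlonglongrightarrow> 0"
proof -
  note [measurable_cong] = sets
  define f where "f K x = min 1 (\<bar>x\<bar> ^ l / K)" for K x :: real
  have f01: "0 \<le> f K x" "f K x \<le> 1" if "K > 0" for K x using that by (auto simp: f_def)
  have int: "integrable G (f K)" if "finite_measure G" "sets G = sets borel" "K > 0" for G K
  proof -
    interpret finite_measure G by fact
    note [measurable_cong] = that(2)
    show ?thesis
      using f01[OF that(3)] by (intro integrable_const_bound[of _ 1]) (auto simp: f_def[abs_def])
  qed
  have "(\<lambda>k. LINT x|H'. f (real (Suc k)) x) \<longlonglongrightarrow> (LINT x|H'. 0)"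
  proof (rule integral_dominated_convergence[where w = "\<lambda>_. 1"])
    interpret finite_measure H' by fact
    show "integrable H' (\<lambda>_. 1::real)" by simp
    show "AE x in H'. (\<lambda>k. f (real (Suc k)) x) \<longlonglongrightarrow> 0"
    proof (rule AE_I2)
      fix x :: real
      have "(\<lambda>k. \<bar>x\<bar> ^ l / real (Suc k)) \<longlonglongrightarrow> 0"
        by (rule LIMSEQ_Suc[OF lim_const_over_n])
      then have "(\<lambda>k. min 1 (\<bar>x\<bar> ^ l / real (Suc k))) \<longlonglongrightarrow> min 1 0"
        by (intro tendsto_min tendsto_const)
      then show "(\<lambda>k. f (real (Suc k)) x) \<longlonglongrightarrow> 0" by (simp add: f_def)
    qed
    show "f (real (Suc k)) \<in> borel_measurable H'" for k
      unfolding f_def[abs_def] by measurable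
    show "AE x in H'. norm (f (real (Suc k)) x) \<le> 1" for k
      using f01[of "real (Suc k)"] by (intro AE_I2) simp
  qed simp
  then have tail: "(\<lambda>k. LINT x|H'. f (real (Suc k)) x) \<longlonglongrightarrow> 0" by simp
  have "(\<lambda>n. LINT x|H n. f (R n) x) \<longlonglongrightarrow> 0"
  proof (rule order_tendstoI)
    fix a :: real assume a: "a < 0"
    have "\<forall>\<^sub>F n in sequentially. 0 < R n" using R by (simp add: filterlim_at_top_dense)
    then show "\<forall>\<^sub>F n in sequentially. a < (LINT x|H n. f (R n) x)"
    proof eventually_elim
      case (elim n)
      have "0 \<le> (LINT x|H n. f (R n) x)"
        using f01[OF elim] by (intro Bochner_Integration.integral_nonneg)
      then show ?case using a by simp
    qed
  next
    fix a :: real assume "0 < a"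
    with tail have "\<forall>\<^sub>F k in sequentially. (LINT x|H'. f (real (Suc k)) x) < a"
      by (rule order_tendstoD)
    then obtain k where k: "(LINT x|H'. f (real (Suc k)) x) < a"
      by (auto simp: eventually_sequentially)
    define K where "K = real (Suc k)"
    have K: "K > 0" by (simp add: K_def)
    have "(\<lambda>n. LINT x|H n. f K x) \<longlonglongrightarrow> (LINT x|H'. f K x)"
    proof (rule integral_tendsto_of_char_tendsto[OF fin sets char])
      show "isCont (f K) x" for x unfolding f_def[abs_def] using K by (intro continuous_intros) simp
      show "\<bar>f K x\<bar> \<le> 1" for x using f01[OF K, of x] by simp
    qed
    then have "\<forall>\<^sub>F n in sequentially. (LINT x|H n. f K x) < a"
      using k by (intro order_tendstoD) (simp_all add: K_def)
    moreover have "\<forall>\<^sub>F n in sequentially. K < R n" using R by (simp add: filterlim_at_top_dense)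
    ultimately show "\<forall>\<^sub>F n in sequentially. (LINT x|H n. f (R n) x) < a"
    proof eventually_elim
      case (elim n)
      have "(LINT x|H n. f (R n) x) \<le> (LINT x|H n. f K x)"
      proof (rule integral_mono)
        show "f (R n) x \<le> f K x" for x
          unfolding f_def using elim K by (intro min.mono order_refl divide_left_mono) auto
      qed (use int fin sets K elim in auto)
      then show ?case using elim by simp
    qed
  qed
  then show ?thesis by (simp add: f_def)
qed

section \<open>Increments of a Levy process\<close>

context
  fixes M :: "'a measure" and L :: "real \<Rightarrow> 'a \<Rightarrow> real" and \<sigma> :: real and \<nu> :: "real \<Rightarrow> real"
  assumes levy: "levy_process_with_density M L \<sigma> \<nu>"
begin

lemma levy_process_of_density: "levy_process M L"
  using levy by (simp add: levy_process_with_density_def)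

lemma levy_prob_space: "prob_space M"
  using levy_process_of_density by (simp add: levy_process_def)

lemma levy_borel: "0 \<le> t \<Longrightarrow> L t \<in> borel_measurable M"
  using levy_process_of_density by (simp add: levy_process_def)

lemma levy_density_of_process: "levy_density \<nu>"
  using levy by (simp add: levy_process_with_density_def levy_density_def)

lemma levy_char:
  "0 \<le> t \<Longrightarrow> char (distr M borel (L t)) u
    = exp (t * levy_exponent (prob_space.expectation M (L 1)) \<sigma> \<nu> u)"
  using levy by (simp add: levy_process_with_density_def)

lemma levy_real_distribution: "0 \<le> t \<Longrightarrow> real_distribution (distr M borel (L t))"
  by (intro prob_space.real_distribution_distr levy_prob_space levy_borel)

lemma increment_borel: "0 \<le> d \<Longrightarrow> increment L d (Suc k) \<in> borel_measurable M"
  using levy_borel[of "real (Suc k) * d"] levy_borel[of "real k * d"]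
  by (simp add: increment_def[abs_def])

text \<open>
  Increments over a grid of step \<open>d\<close> are independent and each has the law of \<open>L d\<close>.
\<close>

lemma char_sum_increments:
  assumes d: "0 \<le> d" and g [measurable]: "g \<in> borel_measurable borel"
  shows "char (distr M borel (\<lambda>\<omega>. \<Sum>k=1..n. g (increment L d k \<omega>))) u
    = char (distr (distr M borel (L d)) borel g) u ^ n"
proof -
  interpret prob_space M by (rule levy_prob_space)
  define X where "X i \<omega> = L (real (Suc i) * d) \<omega> - L (real i * d) \<omega>" for i :: nat and \<omega>
  have "indep_vars (\<lambda>_. borel) (\<lambda>i \<omega>. L ((\<lambda>j. real j * d) (Suc i)) \<omega> - L ((\<lambda>j. real j * d) i) \<omega>) {..<n}"
    using levy_process_of_density[unfolded levy_process_def] d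
    by (elim conjE allE[of _ n] allE[of _ "\<lambda>j. real j * d"]) (auto simp: mult_right_mono)
  then have "indep_vars (\<lambda>_. borel) X {..<n}" by (simp add: X_def[abs_def])
  then have "indep_vars (\<lambda>_. borel) (\<lambda>i \<omega>. g (X i \<omega>)) {..<n}"
    by (rule indep_vars_compose2) simp
  then have "char (distr M borel (\<lambda>\<omega>. \<Sum>i<n. g (X i \<omega>))) u
      = (\<Prod>i<n. char (distr M borel (\<lambda>\<omega>. g (X i \<omega>))) u)"
    by (rule char_distr_sum)
  also have "\<dots> = (\<Prod>i<n. char (distr (distr M borel (L d)) borel g) u)"
  proof (rule prod.cong[OF refl])
    fix i
    have X_borel [measurable]: "X i \<in> borel_measurable M"
      using levy_borel[of "real (Suc i) * d"] levy_borel[of "real i * d"] d by (simp add: X_def[abs_def])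
    have "distr M borel (\<lambda>\<omega>. L (real i * d + d) \<omega> - L (real i * d) \<omega>) = distr M borel (L d)"
      using levy_process_of_density d by (simp add: levy_process_def)
    then have "distr M borel (X i) = distr M borel (L d)"
      by (simp add: X_def[abs_def] algebra_simps)
    then show "char (distr M borel (\<lambda>\<omega>. g (X i \<omega>))) u = char (distr (distr M borel (L d)) borel g) u"
      using distr_distr[OF g X_borel] by (simp add: o_def)
  qed
  also have "\<dots> = char (distr (distr M borel (L d)) borel g) u ^ n" by simp
  also have "(\<lambda>\<omega>. \<Sum>i<n. g (X i \<omega>)) = (\<lambda>\<omega>. \<Sum>k=1..n. g (increment L d k \<omega>))"
  proof
    fix \<omega>
    have "(\<Sum>i<n. g (X i \<omega>)) = (\<Sum>i<n. g (increment L d (Suc i) \<omega>))"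
      by (simp add: X_def increment_def)
    also have "\<dots> = (\<Sum>k=1..n. g (increment L d k \<omega>))"
      by (rule sum.reindex_bij_witness[of _ "\<lambda>k. k - 1" Suc]) auto
    finally show "(\<Sum>i<n. g (X i \<omega>)) = (\<Sum>k=1..n. g (increment L d k \<omega>))" .
  qed
  finally show ?thesis .
qed

lemma sum_increments: "(\<Sum>k=1..n. increment L d k \<omega>) = L (real n * d) \<omega> - L 0 \<omega>"
  by (induction n) (simp_all add: increment_def)

text \<open>
  The increments telescope, so the estimator depends on the process only through its value at the
  horizon \<open>T n\<close>, whose characteristic function is given explicitly. The limit is that of
  the rescaled exponent.
\<close>

lemma mean_estimator_clt:
  assumes step_pos: "\<And>n. 0 < \<Delta> n"
    and horizon: "filterlim (\<lambda>n. real n * \<Delta> n) at_top sequentially"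
  shows "weak_conv_m
      (\<lambda>n. distr M borel
         (\<lambda>\<omega>. sqrt (real n * \<Delta> n) * (b_hat L n (\<Delta> n) \<omega> - prob_space.expectation M (L 1))))
      (normal_law 0 (c_lim \<sigma> \<nu> 2))"
proof -
  interpret prob_space M by (rule levy_prob_space)
  interpret levy_density \<nu> by (rule levy_density_of_process)
  define b where "b = expectation (L 1)"
  define T where "T n = real n * \<Delta> n" for n
  have T0: "0 \<le> T n" for n using step_pos[of n] by (simp add: T_def)
  have T: "filterlim T at_top sequentially" using horizon by (simp add: T_def[abs_def])
  note LT [measurable] = levy_borel[OF T0] and L0 [measurable] = levy_borel[OF order_refl]
  define Y where "Y n \<omega> = sqrt (T n) * (b_hat L n (\<Delta> n) \<omega> - b)" for n \<omega>
  have Y_eq: "Y n \<omega> = sqrt (T n) * ((L (T n) \<omega> - L 0 \<omega>) / T n - b)" for n \<omega>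
    by (simp add: Y_def b_hat_def sum_increments[simplified] T_def)
  have Y_borel [measurable]: "Y n \<in> borel_measurable M" for n
    unfolding Y_eq[abs_def] by measurable
  have c2: "0 \<le> c_lim \<sigma> \<nu> 2"
    by (simp add: c_lim_def density_nonneg Bochner_Integration.integral_nonneg)
  have "weak_conv_m (\<lambda>n. distr M borel (Y n)) (normal_law 0 (c_lim \<sigma> \<nu> 2))"
  proof (rule levy_continuity)
    fix u
    have "(\<lambda>n. exp (T n * levy_exponent b \<sigma> \<nu> (u / sqrt (T n)) - \<i> * u * (sqrt (T n) * b)))
        \<longlonglongrightarrow> exp (complex_of_real (- (c_lim \<sigma> \<nu> 2 * u\<^sup>2 / 2)))"
      by (intro tendsto_exp levy_exponent_rescaled_limit T0 T)
    also have "exp (complex_of_real (- (c_lim \<sigma> \<nu> 2 * u\<^sup>2 / 2))) = char (normal_law 0 (c_lim \<sigma> \<nu> 2)) u"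
      unfolding normal_law_char[OF c2] by (rule exp_of_real)
    finally show "(\<lambda>n. char (distr M borel (Y n)) u) \<longlonglongrightarrow> char (normal_law 0 (c_lim \<sigma> \<nu> 2)) u"
    proof (rule Lim_transform_eventually)
      show "\<forall>\<^sub>F n in sequentially. exp (T n * levy_exponent b \<sigma> \<nu> (u / sqrt (T n)) - \<i> * u * (sqrt (T n) * b))
          = char (distr M borel (Y n)) u"
        using filterlim_at_top_dense[THEN iffD1, OF T, rule_format, of 0]
      proof eventually_elim
        case (elim n)
        have "char (distr M borel (Y n)) u = (CLINT \<omega>|M. iexp (u * Y n \<omega>))"
          unfolding char_def by (rule integral_distr) auto
        also have "\<dots> = (CLINT \<omega>|M. exp (- (\<i> * u * (sqrt (T n) * b))) * iexp (u / sqrt (T n) * L (T n) \<omega>))"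
        proof (rule integral_cong_AE)
          have "AE \<omega> in M. L 0 \<omega> = 0" using levy_process_of_density by (simp add: levy_process_def)
          then show "AE \<omega> in M. iexp (u * Y n \<omega>)
              = exp (- (\<i> * u * (sqrt (T n) * b))) * iexp (u / sqrt (T n) * L (T n) \<omega>)"
          proof eventually_elim
            case (elim \<omega>)
            have "u * Y n \<omega> = - (u * (sqrt (T n) * b)) + u * (sqrt (T n) / T n) * L (T n) \<omega>"
              using elim by (simp add: Y_eq algebra_simps)
            also have "sqrt (T n) / T n = 1 / sqrt (T n)"
              using \<open>0 < T n\<close> by (simp add: divide_simps)
            finally have "u * Y n \<omega> = - (u * (sqrt (T n) * b)) + u / sqrt (T n) * L (T n) \<omega>"
              by simp
            then show ?case
              by (simp only: of_real_add of_real_minus of_real_mult distrib_left exp_add mult_minus_right mult.assoc)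
          qed
        qed measurable
        also have "\<dots> = exp (- (\<i> * u * (sqrt (T n) * b))) * (CLINT \<omega>|M. iexp (u / sqrt (T n) * L (T n) \<omega>))"
          by (rule integral_mult_right_zero)
        also have "(CLINT \<omega>|M. iexp (u / sqrt (T n) * L (T n) \<omega>)) = char (distr M borel (L (T n))) (u / sqrt (T n))"
          unfolding char_def by (rule integral_distr[symmetric]) auto
        also have "\<dots> = exp (T n * levy_exponent b \<sigma> \<nu> (u / sqrt (T n)))"
          unfolding b_def by (rule levy_char[OF T0])
        finally show ?case by (simp add: exp_add[symmetric])
      qed
    qed
  qed (auto intro: real_distribution_normal_law c2)
  then show ?thesis by (simp add: Y_def[abs_def] T_def b_def)
qed

end

section \<open>Power variations at small steps\<close>

text \<open>
  This separates the random part \<open>a\<close> of a centred variable from its deterministic centring \<open>b\<close> in the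
  Lindeberg condition: whichever of the two is larger dominates \<open>\<bar>y\<bar>\<close> up to a factor 2.
\<close>

lemma min_square_cube_split:
  fixes a b y :: real
  assumes "0 \<le> a" "0 \<le> b" "\<bar>y\<bar> \<le> a + b"
  shows "min (y\<^sup>2) (\<bar>y\<bar> ^ 3) \<le> 8 * (a\<^sup>2 * min 1 a) + 4 * b\<^sup>2"
proof (cases "b \<le> a")
  case True
  have y: "\<bar>y\<bar> \<le> 2 * a" using assms True by linarith
  have "\<bar>y\<bar>\<^sup>2 \<le> (2 * a)\<^sup>2" "\<bar>y\<bar> ^ 3 \<le> (2 * a) ^ 3"
    by (intro power_mono y; simp)+
  then have "min (y\<^sup>2) (\<bar>y\<bar> ^ 3) \<le> min (8 * a\<^sup>2) (8 * a ^ 3)"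
    by (intro min.mono) (auto simp: power_mult_distrib intro: order_trans)
  also have "\<dots> = 8 * (a\<^sup>2 * min 1 a)"
    by (simp add: mult_min_right power2_eq_square power3_eq_cube)
  finally show ?thesis by (simp add: add_increasing2)
next
  case False
  have y: "\<bar>y\<bar> \<le> 2 * b" using assms False by linarith
  have "\<bar>y\<bar>\<^sup>2 \<le> (2 * b)\<^sup>2"
    by (intro power_mono y; simp)
  then have "min (y\<^sup>2) (\<bar>y\<bar> ^ 3) \<le> 4 * b\<^sup>2"
    by (simp add: power_mult_distrib min.coboundedI1)
  then show ?thesis using assms by (simp add: add_increasing)
qed

lemma finite_measure_density_integrable:
  assumes w: "integrable G w" and w0: "\<And>x. 0 \<le> w x"
  shows "finite_measure (density G (\<lambda>x. ennreal (w x)))"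
proof
  note [measurable] = borel_measurable_integrable[OF w]
  have "emeasure (density G (\<lambda>x. ennreal (w x))) (space G) = (\<integral>\<^sup>+x. ennreal (w x) * indicator (space G) x \<partial>G)"
    by (subst emeasure_density) auto
  also have "\<dots> = (\<integral>\<^sup>+x. w x \<partial>G)" by (rule nn_integral_cong) simp
  also have "\<dots> = ennreal (LINT x|G. w x)" using w w0 by (intro nn_integral_eq_integral) auto
  finally show "emeasure (density G (\<lambda>x. ennreal (w x))) (space (density G (\<lambda>x. ennreal (w x)))) \<noteq> \<infinity>"
    by simp
qed

text \<open>
  Weighting by an even power gives a positive measure, whose Fourier transform is a derivative of the
  original one up to the sign of \<open>\<i> ^ (2 * l)\<close>.
\<close>

lemma char_density_even_power:
  assumes G: "sets G = sets borel" and a: "0 \<le> a"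
  shows "char (density G (\<lambda>x. ennreal (a * x ^ (2 * l)))) u = a * ((- 1) ^ l * fourier_moment G (2 * l) u)"
proof -
  note [measurable_cong] = G
  have "char (density G (\<lambda>x. ennreal (a * x ^ (2 * l)))) u = (CLINT x|G. (a * x ^ (2 * l)) *\<^sub>R iexp (u * x))"
    unfolding char_def using a by (intro integral_density) (auto simp: zero_le_even_power)
  also have "\<dots> = (CLINT x|G. a * ((- 1) ^ l * ((\<i> * x) ^ (2 * l) * iexp (u * x))))"
  proof (intro Bochner_Integration.integral_cong refl)
    fix x :: real
    have "(- 1) ^ l * ((\<i> * x)\<^sup>2) ^ l = (- 1 * (\<i> * x)\<^sup>2) ^ l"
      by (rule power_mult_distrib[symmetric])
    also have "- 1 * (\<i> * x)\<^sup>2 = complex_of_real (x\<^sup>2)" by (simp add: power_mult_distrib)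
    finally have "(- 1) ^ l * (\<i> * x) ^ (2 * l) = complex_of_real (x ^ (2 * l))"
      by (simp add: power_mult)
    then show "(a * x ^ (2 * l)) *\<^sub>R iexp (u * x) = a * ((- 1) ^ l * ((\<i> * x) ^ (2 * l) * iexp (u * x)))"
      by (simp add: scaleR_conv_of_real flip: mult.assoc)
  qed
  also have "\<dots> = a * ((- 1) ^ l * fourier_moment G (2 * l) u)"
    unfolding fourier_moment_def by (simp only: integral_mult_right_zero)
  finally show ?thesis .
qed

locale small_step_levy = levy_density \<nu>
  for \<nu> :: "real \<Rightarrow> real" +
  fixes M :: "'a measure" and L :: "real \<Rightarrow> 'a \<Rightarrow> real" and \<sigma> :: real
    and \<Delta> :: "nat \<Rightarrow> real" and l :: nat
  assumes levy: "levy_process_with_density M L \<sigma> \<nu>"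
    and step_pos: "\<And>n. 0 < \<Delta> n"
    and step_lim: "\<Delta> \<longlonglongrightarrow> 0"
    and l: "2 \<le> l"
    and levy_moments: "\<And>j. 2 \<le> j \<Longrightarrow> j \<le> 2 * l \<Longrightarrow> integrable N (\<lambda>x. x ^ j)"
begin

definition "incr_law n = distr M borel (L (\<Delta> n))"

definition "exponent_deriv = levy_exponent_deriv (prob_space.expectation M (L 1)) \<sigma> \<nu>"

sublocale incr_law: real_distribution "incr_law n" for n
  unfolding incr_law_def using levy step_pos by (intro levy_real_distribution) (auto intro: less_imp_le)

text \<open>
  The exponent is \<open>2 * l\<close> times differentiable because the Levy measure has all moments of orders 2 to \<open>2 * l\<close>, hence
  so is the characteristic function of an increment.
\<close>

lemma increment_law_moments:
  "integrable (incr_law n) (\<lambda>x. x ^ (2 * l))"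
  "m \<le> 2 * l \<Longrightarrow> fourier_moment (incr_law n) m = exp_deriv exponent_deriv (\<Delta> n) m"
proof -
  have "integrable (incr_law n) (\<lambda>x. x ^ (2 * l)) \<and> (\<forall>m\<le>2 * l. fourier_moment (incr_law n) m = exp_deriv exponent_deriv (\<Delta> n) m)"
  proof (rule moments_of_smooth_char[OF incr_law.real_distribution_axioms])
    show "exp_deriv exponent_deriv (\<Delta> n) 0 = char (incr_law n)"
      using levy_char[OF levy less_imp_le[OF step_pos]]
      by (simp add: fun_eq_iff incr_law_def exponent_deriv_def levy_exponent_deriv_def)
    show "(exp_deriv exponent_deriv (\<Delta> n) j has_vector_derivative exp_deriv exponent_deriv (\<Delta> n) (Suc j) u) (at u)"
      if "j < 2 * l" for j u
      using that unfolding exponent_deriv_def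
      by (intro has_vector_derivative_exp_deriv[where K = "2 * l"]
          has_vector_derivative_levy_exponent_deriv[where K = "2 * l"] levy_moments)
  qed
  then show "integrable (incr_law n) (\<lambda>x. x ^ (2 * l))"
    "m \<le> 2 * l \<Longrightarrow> fourier_moment (incr_law n) m = exp_deriv exponent_deriv (\<Delta> n) m" by auto
qed

lemma increment_law_moment_l: "integrable (incr_law n) (\<lambda>x. x ^ l)"
proof (rule incr_law.square_integrable_imp_integrable)
  show "integrable (incr_law n) (\<lambda>x. (x ^ l)\<^sup>2)"
    using increment_law_moments(1) by (simp add: power_mult[symmetric] mult.commute)
qed simp

lemma eventually_step_le_1: "\<forall>\<^sub>F n in sequentially. \<Delta> n \<le> 1"
  using order_tendstoD(2)[OF step_lim zero_less_one] by eventually_elim simp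

lemma fourier_moment_small_time:
  assumes m: "1 \<le> m" "m \<le> 2 * l"
  obtains C where "0 \<le> C"
    "\<forall>\<^sub>F n in sequentially. norm (fourier_moment (incr_law n) m u - \<Delta> n * exponent_deriv m u) \<le> C * (\<Delta> n)\<^sup>2"
proof -
  obtain k where k: "m = Suc k" using m by (cases m) auto
  obtain C where C: "C \<ge> 0" "\<And>t. t \<in> {0..1} \<Longrightarrow> norm (exp_deriv exponent_deriv t m u - t * exponent_deriv m u) \<le> C * t\<^sup>2"
    using exp_deriv_first_order[of exponent_deriv k u] unfolding k by blast
  have "\<forall>\<^sub>F n in sequentially. norm (fourier_moment (incr_law n) m u - \<Delta> n * exponent_deriv m u) \<le> C * (\<Delta> n)\<^sup>2"
    using eventually_step_le_1
  proof eventually_elim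
    case (elim n)
    then show ?case
      unfolding increment_law_moments(2)[OF m(2)] using step_pos[of n] by (intro C(2)) auto
  qed
  with C(1) show ?thesis by (rule that)
qed

lemma fourier_moment_rescaled_limit:
  assumes m: "1 \<le> m" "m \<le> 2 * l"
  shows "(\<lambda>n. fourier_moment (incr_law n) m u / \<Delta> n) \<longlonglongrightarrow> exponent_deriv m u"
proof -
  obtain C where C: "0 \<le> C"
    "\<forall>\<^sub>F n in sequentially. norm (fourier_moment (incr_law n) m u - \<Delta> n * exponent_deriv m u) \<le> C * (\<Delta> n)\<^sup>2"
    using fourier_moment_small_time[OF m] .
  have "\<forall>\<^sub>F n in sequentially. norm (fourier_moment (incr_law n) m u / \<Delta> n - exponent_deriv m u) \<le> C * \<Delta> n"
    using C(2)
  proof eventually_elim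
    case (elim n)
    have "fourier_moment (incr_law n) m u / \<Delta> n - exponent_deriv m u = (fourier_moment (incr_law n) m u - \<Delta> n * exponent_deriv m u) / \<Delta> n"
      using step_pos[of n] by (simp add: field_simps)
    then have "norm (fourier_moment (incr_law n) m u / \<Delta> n - exponent_deriv m u)
        = norm (fourier_moment (incr_law n) m u - \<Delta> n * exponent_deriv m u) / \<Delta> n"
      using step_pos[of n] by (simp add: norm_divide)
    also have "\<dots> \<le> C * (\<Delta> n)\<^sup>2 / \<Delta> n"
      using elim step_pos[of n] by (intro divide_right_mono) auto
    finally show ?case using step_pos[of n] by (simp add: power2_eq_square)
  qed
  moreover have "(\<lambda>n. C * \<Delta> n) \<longlonglongrightarrow> 0" using tendsto_mult_right_zero[OF step_lim] .
  ultimately have "(\<lambda>n. fourier_moment (incr_law n) m u / \<Delta> n - exponent_deriv m u) \<longlonglongrightarrow> 0" by (rule Lim_null_comparison)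
  then show ?thesis by (rule LIM_zero_cancel)
qed

lemma moment_small_time:
  assumes m: "2 \<le> m" "m \<le> 2 * l"
  obtains C where "0 \<le> C"
    "\<forall>\<^sub>F n in sequentially. \<bar>(LINT x|incr_law n. x ^ m) - \<Delta> n * c_lim \<sigma> \<nu> m\<bar> \<le> C * (\<Delta> n)\<^sup>2"
proof -
  obtain C where C: "0 \<le> C"
    "\<forall>\<^sub>F n in sequentially. norm (fourier_moment (incr_law n) m 0 - \<Delta> n * exponent_deriv m 0) \<le> C * (\<Delta> n)\<^sup>2"
    using fourier_moment_small_time[of m 0] m by auto
  have "fourier_moment (incr_law n) m 0 - \<Delta> n * exponent_deriv m 0
      = \<i> ^ m * complex_of_real ((LINT x|incr_law n. x ^ m) - \<Delta> n * c_lim \<sigma> \<nu> m)" for n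
    unfolding fourier_moment_at_0 exponent_deriv_def levy_exponent_deriv_at_0[OF m(1)]
    by (simp add: algebra_simps)
  then have "norm (fourier_moment (incr_law n) m 0 - \<Delta> n * exponent_deriv m 0) = \<bar>(LINT x|incr_law n. x ^ m) - \<Delta> n * c_lim \<sigma> \<nu> m\<bar>" for n
    by (simp only: norm_mult norm_power norm_of_real) simp
  with C show ?thesis using that by simp
qed

lemma moment_rescaled_limit:
  assumes m: "2 \<le> m" "m \<le> 2 * l"
  shows "(\<lambda>n. (LINT x|incr_law n. x ^ m) / \<Delta> n) \<longlonglongrightarrow> c_lim \<sigma> \<nu> m"
proof -
  obtain C where C: "0 \<le> C"
    "\<forall>\<^sub>F n in sequentially. \<bar>(LINT x|incr_law n. x ^ m) - \<Delta> n * c_lim \<sigma> \<nu> m\<bar> \<le> C * (\<Delta> n)\<^sup>2"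
    using moment_small_time[OF m] .
  have "\<forall>\<^sub>F n in sequentially. norm ((LINT x|incr_law n. x ^ m) / \<Delta> n - c_lim \<sigma> \<nu> m) \<le> C * \<Delta> n"
    using C(2)
  proof eventually_elim
    case (elim n)
    have "(LINT x|incr_law n. x ^ m) / \<Delta> n - c_lim \<sigma> \<nu> m = ((LINT x|incr_law n. x ^ m) - \<Delta> n * c_lim \<sigma> \<nu> m) / \<Delta> n"
      using step_pos[of n] by (simp add: field_simps)
    then have "norm ((LINT x|incr_law n. x ^ m) / \<Delta> n - c_lim \<sigma> \<nu> m)
        = \<bar>(LINT x|incr_law n. x ^ m) - \<Delta> n * c_lim \<sigma> \<nu> m\<bar> / \<Delta> n"
      using step_pos[of n] by simp
    also have "\<dots> \<le> C * (\<Delta> n)\<^sup>2 / \<Delta> n"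
      using elim step_pos[of n] by (intro divide_right_mono) auto
    finally show ?case using step_pos[of n] by (simp add: power2_eq_square)
  qed
  moreover have "(\<lambda>n. C * \<Delta> n) \<longlonglongrightarrow> 0" using tendsto_mult_right_zero[OF step_lim] .
  ultimately have "(\<lambda>n. (LINT x|incr_law n. x ^ m) / \<Delta> n - c_lim \<sigma> \<nu> m) \<longlonglongrightarrow> 0" by (rule Lim_null_comparison)
  then show ?thesis by (rule LIM_zero_cancel)
qed

text \<open>
  The measures \<open>x ^ (2 * l) / \<Delta> n\<close> against the law of an increment converge weakly to
  \<open>x ^ (2 * l)\<close> against the Levy measure: their Fourier transforms are, up to sign, the derivatives of order
  \<open>2 * l\<close> of the characteristic functions divided by \<open>\<Delta> n\<close>, which converge to the derivative of the exponent.
  Tightness of these measures is the Lindeberg condition for the \<open>l\<close>-th powers of the increments.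
\<close>

lemma small_time_uniform_integrability:
  assumes R: "filterlim R at_top sequentially"
  shows "(\<lambda>n. LINT x|incr_law n. x ^ (2 * l) / \<Delta> n * min 1 (\<bar>x\<bar> ^ l / R n)) \<longlonglongrightarrow> 0"
proof -
  define H where "H n = density (incr_law n) (\<lambda>x. ennreal (1 / \<Delta> n * x ^ (2 * l)))" for n
  define H' where "H' = density N (\<lambda>x. ennreal (1 * x ^ (2 * l)))"
  have "(\<lambda>n. LINT x|H n. min 1 (\<bar>x\<bar> ^ l / R n)) \<longlonglongrightarrow> 0"
  proof (rule integral_min_power_tendsto_0[OF _ _ _ _ _ R])
    show "finite_measure (H n)" for n
      unfolding H_def using step_pos[of n]
      by (intro finite_measure_density_integrable integrable_mult_right increment_law_moments)
        (auto simp: zero_le_even_power)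
    show "finite_measure H'"
      unfolding H'_def using l
      by (intro finite_measure_density_integrable integrable_mult_right levy_moments)
        (auto simp: zero_le_even_power)
    show "(\<lambda>n. char (H n) u) \<longlonglongrightarrow> char H' u" for u
    proof -
      have "(\<lambda>n. (- 1) ^ l * (fourier_moment (incr_law n) (2 * l) u / \<Delta> n)) \<longlonglongrightarrow> (- 1) ^ l * exponent_deriv (2 * l) u"
        using l by (intro tendsto_mult_left fourier_moment_rescaled_limit) auto
      moreover have "char (H n) u = (- 1) ^ l * (fourier_moment (incr_law n) (2 * l) u / \<Delta> n)" for n
        unfolding H_def using step_pos[of n] by (subst char_density_even_power) auto
      moreover have "char H' u = (- 1) ^ l * exponent_deriv (2 * l) u"
        unfolding H'_def using l
        by (subst char_density_even_power) (auto simp: exponent_deriv_def levy_exponent_deriv_def)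
      ultimately show ?thesis by simp
    qed
  qed (simp_all add: H_def H'_def)
  moreover have "(LINT x|H n. min 1 (\<bar>x\<bar> ^ l / R n)) = (LINT x|incr_law n. x ^ (2 * l) / \<Delta> n * min 1 (\<bar>x\<bar> ^ l / R n))" for n
    unfolding H_def using step_pos[of n]
    by (subst integral_density) (auto simp: zero_le_even_power)
  ultimately show ?thesis by simp
qed

text \<open>
  The rescaled estimation error is a sum of \<open>n\<close> independent copies of \<open>(Z ^ l - \<Delta> n * c) / sqrt (T n)\<close>, where
  \<open>T n = n * \<Delta> n\<close>. The total mean of such a row is \<open>sqrt (T n)\<close> times the bias of \<open>Z ^ l / \<Delta> n\<close>, of size
  \<open>sqrt (n * \<Delta> n ^ 3)\<close>; this is where the condition on \<open>n * \<Delta> n ^ 3\<close> enters. The total variance converges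
  to the moment of order \<open>2 * l\<close>, since squares of means are of order \<open>\<Delta> n\<^sup>2\<close> and thus negligible.
\<close>

lemma power_variation_clt:
  assumes horizon: "filterlim (\<lambda>n. real n * \<Delta> n) at_top sequentially"
    and bias: "(\<lambda>n. real n * \<Delta> n ^ 3) \<longlonglongrightarrow> 0"
  shows "weak_conv_m
      (\<lambda>n. distr M borel (\<lambda>\<omega>. sqrt (real n * \<Delta> n) * (c_hat L l n (\<Delta> n) \<omega> - c_lim \<sigma> \<nu> l)))
      (normal_law 0 (c_lim \<sigma> \<nu> (2 * l)))"
proof -
  interpret M: prob_space M using levy by (rule levy_prob_space)
  define c where "c = c_lim \<sigma> \<nu> l"
  define v where "v = c_lim \<sigma> \<nu> (2 * l)"
  define T where "T n = real n * \<Delta> n" for n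
  define y where "y n x = (x ^ l - \<Delta> n * c) / sqrt (T n)" for n x
  define Q where "Q n = distr (incr_law n) borel (y n)" for n
  have T: "filterlim T at_top sequentially" using horizon by (simp add: T_def[abs_def])
  have Tpos: "0 < T n" if "0 < n" for n using that step_pos[of n] by (simp add: T_def)
  have T0: "0 \<le> T n" for n using step_pos[of n] by (simp add: T_def)
  have nT: "real n / T n = 1 / \<Delta> n" if "0 < n" for n using that by (simp add: T_def)
  have v0: "0 \<le> v"
    using l by (auto simp: v_def c_lim_def density_nonneg zero_le_even_power
        intro!: Bochner_Integration.integral_nonneg)
  have y_borel [measurable]: "y n \<in> borel_measurable borel" for n unfolding y_def[abs_def] by measurable
  have mass [simp]: "measure (incr_law n) UNIV = 1" for n using incr_law.prob_space[of n] by simp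
  note intl = increment_law_moment_l and int2l = increment_law_moments(1)
  have ysq: "(y n x)\<^sup>2 = (x ^ (2 * l) - 2 * \<Delta> n * c * x ^ l + (\<Delta> n)\<^sup>2 * c\<^sup>2) / T n" for n x
    using T0[of n]
    by (simp add: y_def power_divide power2_diff power_mult_distrib power_mult[symmetric] mult_ac)
  have int_ysq: "integrable (incr_law n) (\<lambda>x. (y n x)\<^sup>2)" for n
    unfolding ysq using intl int2l by (intro integrable_divide Bochner_Integration.integrable_add
        Bochner_Integration.integrable_diff integrable_mult_right incr_law.integrable_const)
  have Q_int: "(LINT x|Q n. g x) = (LINT x|incr_law n. g (y n x))" if "g \<in> borel_measurable borel" for n and g :: "real \<Rightarrow> real"
    unfolding Q_def using that by (intro integral_distr) auto
  have mean_l: "(\<lambda>n. LINT x|incr_law n. x ^ l) \<longlonglongrightarrow> 0"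
  proof -
    have "(\<lambda>n. (LINT x|incr_law n. x ^ l) / \<Delta> n * \<Delta> n) \<longlonglongrightarrow> c_lim \<sigma> \<nu> l * 0"
      using l by (intro tendsto_mult moment_rescaled_limit step_lim) auto
    then show ?thesis using step_pos by (simp add: less_imp_neq[symmetric])
  qed
  have "(\<lambda>n. char (Q n) u ^ n) \<longlonglongrightarrow> exp (- (v * u\<^sup>2 / 2))" for u
  proof (rule char_power_tendsto_normal)
    show "real_distribution (Q n)" for n
      unfolding Q_def by (rule incr_law.real_distribution_distr) simp
    show "integrable (Q n) (\<lambda>x. x\<^sup>2)" for n
      unfolding Q_def using int_ysq[of n] by (subst integrable_distr_eq) auto
    show "(\<lambda>n. real n * (LINT x|Q n. x)) \<longlonglongrightarrow> 0"
    proof -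
      obtain C where C: "0 \<le> C" "\<forall>\<^sub>F n in sequentially. \<bar>(LINT x|incr_law n. x ^ l) - \<Delta> n * c\<bar> \<le> C * (\<Delta> n)\<^sup>2"
        using moment_small_time[of l] l unfolding c_def by auto
      have "\<forall>\<^sub>F n in sequentially. norm (real n * (LINT x|Q n. x)) \<le> C * sqrt (real n * \<Delta> n ^ 3)"
        using C(2) eventually_gt_at_top[of "0::nat"]
      proof eventually_elim
        case (elim n)
        have "(LINT x|Q n. x) = ((LINT x|incr_law n. x ^ l) - \<Delta> n * c) / sqrt (T n)"
          using intl[of n] by (simp add: Q_int y_def)
        then have "norm (real n * (LINT x|Q n. x)) = real n * \<bar>(LINT x|incr_law n. x ^ l) - \<Delta> n * c\<bar> / sqrt (T n)"
          using T0[of n] by (simp add: abs_mult)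
        also have "\<dots> \<le> real n * (C * (\<Delta> n)\<^sup>2) / sqrt (T n)"
          using elim T0[of n] by (intro divide_right_mono mult_left_mono) auto
        also have "real n * (C * (\<Delta> n)\<^sup>2) = C * sqrt (real n * \<Delta> n ^ 3) * sqrt (T n)"
        proof -
          \<comment> \<open>The product under the root is \<open>n\<^sup>2 * \<Delta> n ^ 4\<close>, a perfect square.\<close>
          have "sqrt (real n * \<Delta> n ^ 3) * sqrt (T n) = sqrt ((real n * (\<Delta> n)\<^sup>2)\<^sup>2)"
            unfolding real_sqrt_mult[symmetric] T_def
            by (simp add: power2_eq_square power3_eq_cube mult_ac)
          then show ?thesis by simp
        qed
        finally show ?case using Tpos[OF elim(2)] by simp
      qed
      moreover have "(\<lambda>n. C * sqrt (real n * \<Delta> n ^ 3)) \<longlonglongrightarrow> 0"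
        using tendsto_mult_right_zero[OF tendsto_real_sqrt[OF bias, simplified]] .
      ultimately show ?thesis by (rule Lim_null_comparison)
    qed
    show "(\<lambda>n. real n * (LINT x|Q n. x\<^sup>2)) \<longlonglongrightarrow> v"
    proof -
      have "(\<lambda>n. (LINT x|incr_law n. x ^ (2 * l)) / \<Delta> n - 2 * c * (LINT x|incr_law n. x ^ l) + \<Delta> n * c\<^sup>2)
          \<longlonglongrightarrow> v - 2 * c * 0 + 0 * c\<^sup>2"
        unfolding v_def using l by (intro tendsto_intros moment_rescaled_limit mean_l step_lim) auto
      moreover have "\<forall>\<^sub>F n in sequentially. (LINT x|incr_law n. x ^ (2 * l)) / \<Delta> n - 2 * c * (LINT x|incr_law n. x ^ l) + \<Delta> n * c\<^sup>2
          = real n * (LINT x|Q n. x\<^sup>2)"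
        using eventually_gt_at_top[of "0::nat"]
      proof eventually_elim
        case (elim n)
        have "(LINT x|Q n. x\<^sup>2)
            = ((LINT x|incr_law n. x ^ (2 * l)) - 2 * \<Delta> n * c * (LINT x|incr_law n. x ^ l) + (\<Delta> n)\<^sup>2 * c\<^sup>2) / T n"
          using intl[of n] int2l[of n] by (simp add: Q_int ysq)
        then have "real n * (LINT x|Q n. x\<^sup>2)
            = real n / T n * ((LINT x|incr_law n. x ^ (2 * l)) - 2 * \<Delta> n * c * (LINT x|incr_law n. x ^ l) + (\<Delta> n)\<^sup>2 * c\<^sup>2)"
          by simp
        then show ?case
          unfolding nT[OF elim] using step_pos[of n] by (simp add: field_simps power2_eq_square)
      qed
      ultimately show ?thesis using Lim_transform_eventually by force
    qed
    show "(\<lambda>n. real n * (LINT x|Q n. min (x\<^sup>2) (\<bar>x\<bar> ^ 3))) \<longlonglongrightarrow> 0"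
    proof -
      define J where "J n = (LINT x|incr_law n. x ^ (2 * l) / \<Delta> n * min 1 (\<bar>x\<bar> ^ l / sqrt (T n)))" for n
      have J: "J \<longlonglongrightarrow> 0"
        unfolding J_def[abs_def]
        by (rule small_time_uniform_integrability[OF filterlim_compose[OF sqrt_at_top T]])
      have "\<forall>\<^sub>F n in sequentially. norm (real n * (LINT x|Q n. min (x\<^sup>2) (\<bar>x\<bar> ^ 3))) \<le> 8 * J n + 4 * c\<^sup>2 * \<Delta> n"
        using eventually_gt_at_top[of "0::nat"]
      proof eventually_elim
        case (elim n)
        define A where "A x = \<bar>x\<bar> ^ l / sqrt (T n)" for x :: real
        define B where "B = \<Delta> n * \<bar>c\<bar> / sqrt (T n)"
        have A0: "0 \<le> A x" for x by (simp add: A_def T0)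
        have A2: "(A x)\<^sup>2 = x ^ (2 * l) / T n" for x
          using T0[of n] by (simp add: A_def power_divide power_mult[symmetric] mult.commute power_even_abs)
        have B2: "B\<^sup>2 = (\<Delta> n)\<^sup>2 * c\<^sup>2 / T n"
          using T0[of n] by (simp add: B_def power_divide power_mult_distrib)
        have A_int: "integrable (incr_law n) (\<lambda>x. (A x)\<^sup>2 * min 1 (A x))"
        proof (rule Bochner_Integration.integrable_bound)
          show "integrable (incr_law n) (\<lambda>x. x ^ (2 * l) / T n)" using int2l by (rule integrable_divide)
          show "AE x in incr_law n. norm ((A x)\<^sup>2 * min 1 (A x)) \<le> norm (x ^ (2 * l) / T n)"
            unfolding A2[symmetric] using A0 by (intro AE_I2) (simp add: abs_mult mult_left_le)
        qed (simp add: A_def[abs_def])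
        have "(LINT x|Q n. min (x\<^sup>2) (\<bar>x\<bar> ^ 3)) = (LINT x|incr_law n. min ((y n x)\<^sup>2) (\<bar>y n x\<bar> ^ 3))"
          by (rule Q_int) measurable
        also have "\<dots> \<le> (LINT x|incr_law n. 8 * ((A x)\<^sup>2 * min 1 (A x)) + 4 * B\<^sup>2)"
        proof (rule integral_mono)
          show "integrable (incr_law n) (\<lambda>x. min ((y n x)\<^sup>2) (\<bar>y n x\<bar> ^ 3))"
            by (rule Bochner_Integration.integrable_bound[OF int_ysq[of n]]) auto
          show "integrable (incr_law n) (\<lambda>x. 8 * ((A x)\<^sup>2 * min 1 (A x)) + 4 * B\<^sup>2)"
            by (intro Bochner_Integration.integrable_add integrable_mult_right A_int incr_law.integrable_const)
          show "min ((y n x)\<^sup>2) (\<bar>y n x\<bar> ^ 3) \<le> 8 * ((A x)\<^sup>2 * min 1 (A x)) + 4 * B\<^sup>2" for x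
          proof (rule min_square_cube_split[OF A0])
            show "0 \<le> B" using step_pos[of n] T0[of n] by (simp add: B_def)
            have "\<bar>x ^ l - \<Delta> n * c\<bar> \<le> \<bar>x\<bar> ^ l + \<Delta> n * \<bar>c\<bar>"
              using abs_triangle_ineq4[of "x ^ l" "\<Delta> n * c"] step_pos[of n] by (simp add: abs_mult power_abs)
            then have "\<bar>x ^ l - \<Delta> n * c\<bar> / sqrt (T n) \<le> (\<bar>x\<bar> ^ l + \<Delta> n * \<bar>c\<bar>) / sqrt (T n)"
              using T0[of n] by (intro divide_right_mono) auto
            then show "\<bar>y n x\<bar> \<le> A x + B"
              using T0[of n] by (simp add: y_def A_def B_def add_divide_distrib)
          qed
        qed
        also have "\<dots> = 8 * (LINT x|incr_law n. (A x)\<^sup>2 * min 1 (A x)) + 4 * B\<^sup>2"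
          using A_int by simp
        finally have "real n * (LINT x|Q n. min (x\<^sup>2) (\<bar>x\<bar> ^ 3))
            \<le> real n * (8 * (LINT x|incr_law n. (A x)\<^sup>2 * min 1 (A x)) + 4 * B\<^sup>2)"
          by (rule mult_left_mono) simp
        also have "\<dots> = 8 * (real n * (LINT x|incr_law n. (A x)\<^sup>2 * min 1 (A x))) + 4 * (real n * B\<^sup>2)"
          by (simp add: algebra_simps)
        also have "real n * (LINT x|incr_law n. (A x)\<^sup>2 * min 1 (A x)) = (LINT x|incr_law n. real n * ((A x)\<^sup>2 * min 1 (A x)))"
          by simp
        also have "\<dots> = J n"
          unfolding J_def A2 using elim by (intro Bochner_Integration.integral_cong refl) (simp add: T_def A_def)
        also have "real n * B\<^sup>2 = c\<^sup>2 * \<Delta> n"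
          unfolding B2 using elim step_pos[of n] by (simp add: T_def power2_eq_square)
        finally have "real n * (LINT x|Q n. min (x\<^sup>2) (\<bar>x\<bar> ^ 3)) \<le> 8 * J n + 4 * c\<^sup>2 * \<Delta> n" by simp
        moreover have "0 \<le> (LINT x|Q n. min (x\<^sup>2) (\<bar>x\<bar> ^ 3))"
          by (intro Bochner_Integration.integral_nonneg) simp
        ultimately show ?case by simp
      qed
      moreover have "(\<lambda>n. 8 * J n + 4 * c\<^sup>2 * \<Delta> n) \<longlonglongrightarrow> 8 * 0 + 4 * c\<^sup>2 * 0"
        by (intro tendsto_intros J step_lim)
      then have "(\<lambda>n. 8 * J n + 4 * c\<^sup>2 * \<Delta> n) \<longlonglongrightarrow> 0" by simp
      ultimately show ?thesis by (rule Lim_null_comparison)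
    qed
  qed
  note Q_lim = this
  define Z where "Z n \<omega> = sqrt (T n) * (c_hat L l n (\<Delta> n) \<omega> - c)" for n \<omega>
  have Z_borel [measurable]: "Z n \<in> borel_measurable M" for n
  proof -
    have "increment L (\<Delta> n) k \<in> borel_measurable M" if "k \<in> {1..n}" for k
      using increment_borel[OF levy less_imp_le[OF step_pos[of n]], of "k - 1"] that by simp
    then show ?thesis unfolding Z_def[abs_def] c_hat_def[abs_def]
      by (intro borel_measurable_times borel_measurable_diff borel_measurable_sum borel_measurable_power
          borel_measurable_const)
  qed
  have Z_eq: "Z n \<omega> = (\<Sum>k=1..n. y n (increment L (\<Delta> n) k \<omega>))" if "0 < n" for n \<omega>
  proof -
    have "(\<Sum>k=1..n. y n (increment L (\<Delta> n) k \<omega>))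
        = ((\<Sum>k=1..n. increment L (\<Delta> n) k \<omega> ^ l) - T n * c) / sqrt (T n)"
      by (simp add: y_def sum_divide_distrib[symmetric] sum_subtractf T_def)
    also have "\<dots> = sqrt (T n) * ((\<Sum>k=1..n. increment L (\<Delta> n) k \<omega> ^ l) / T n - c)"
    proof -
      have "T n = sqrt (T n) * sqrt (T n)" using T0[of n] by simp
      then show ?thesis using Tpos[OF that] by (simp add: field_simps)
    qed
    finally show ?thesis by (simp add: Z_def c_hat_def T_def)
  qed
  have "weak_conv_m (\<lambda>n. distr M borel (Z n)) (normal_law 0 v)"
  proof (rule levy_continuity)
    fix u
    have "\<forall>\<^sub>F n in sequentially. char (Q n) u ^ n = char (distr M borel (Z n)) u"
      using eventually_gt_at_top[of "0::nat"]
    proof eventually_elim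
      case (elim n)
      have "Z n = (\<lambda>\<omega>. \<Sum>k=1..n. y n (increment L (\<Delta> n) k \<omega>))" using Z_eq[OF elim] by (simp add: fun_eq_iff)
      then show ?case
        using char_sum_increments[OF levy less_imp_le[OF step_pos[of n]] y_borel[of n], of n u]
        by (simp add: Q_def incr_law_def)
    qed
    then show "(\<lambda>n. char (distr M borel (Z n)) u) \<longlonglongrightarrow> char (normal_law 0 v) u"
      unfolding normal_law_char[OF v0] using Lim_transform_eventually[OF Q_lim] by simp
  qed (auto intro: real_distribution_normal_law v0)
  then show ?thesis by (simp add: Z_def[abs_def] T_def c_def v_def)
qed

end

theorem proposition5p2:
  fixes M :: "'a measure"
    and L :: "real \<Rightarrow> 'a \<Rightarrow> real"
    and \<sigma> :: real
    and \<nu> :: "real \<Rightarrow> real"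
    and \<Delta> :: "nat \<Rightarrow> real"
  assumes levy: "levy_process_with_density M L \<sigma> \<nu>"
    and step_pos: "\<And>n. 0 < \<Delta> n"
    and step_lim: "\<Delta> \<longlonglongrightarrow> 0"
    and horizon: "filterlim (\<lambda>n. real n * \<Delta> n) at_top sequentially"
  shows
    "((\<exists>\<epsilon>>0. integrable lborel (\<lambda>x. \<bar>x\<bar> powr (2 + \<epsilon>) * \<nu> x)) \<longrightarrow>
        weak_conv_m
          (\<lambda>n. distr M borel
             (\<lambda>\<omega>. sqrt (real n * \<Delta> n) * (b_hat L n (\<Delta> n) \<omega> - prob_space.expectation M (L 1))))
          (normal_law 0 (c_lim \<sigma> \<nu> 2))) \<and>
     (\<forall>l\<ge>2. (\<exists>\<epsilon>>0. integrable lborel (\<lambda>x. \<bar>x\<bar> powr (2 * (real l + \<epsilon>)) * \<nu> x)) \<and>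
        (\<lambda>n. real n * \<Delta> n ^ 3) \<longlonglongrightarrow> 0 \<longrightarrow>
        weak_conv_m
          (\<lambda>n. distr M borel
             (\<lambda>\<omega>. sqrt (real n * \<Delta> n) * (c_hat L l n (\<Delta> n) \<omega> - c_lim \<sigma> \<nu> l)))
          (normal_law 0 (c_lim \<sigma> \<nu> (2 * l))))"
proof (intro conjI impI allI)
  show "weak_conv_m
      (\<lambda>n. distr M borel
         (\<lambda>\<omega>. sqrt (real n * \<Delta> n) * (b_hat L n (\<Delta> n) \<omega> - prob_space.expectation M (L 1))))
      (normal_law 0 (c_lim \<sigma> \<nu> 2))"
    by (rule mean_estimator_clt[OF levy step_pos horizon])
next
  fix l :: nat
  assume l: "2 \<le> l"
    and *: "(\<exists>\<epsilon>>0. integrable lborel (\<lambda>x. \<bar>x\<bar> powr (2 * (real l + \<epsilon>)) * \<nu> x)) \<and>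
      (\<lambda>n. real n * \<Delta> n ^ 3) \<longlonglongrightarrow> 0"
  then obtain \<epsilon> where \<epsilon>: "0 < \<epsilon>" "integrable lborel (\<lambda>x. \<bar>x\<bar> powr (2 * (real l + \<epsilon>)) * \<nu> x)"
    by blast
  interpret levy_density \<nu> by (rule levy_density_of_process[OF levy])
  interpret small_step_levy \<nu> M L \<sigma> \<Delta> l
  proof
    fix j assume "2 \<le> j" "j \<le> 2 * l"
    then show "integrable N (\<lambda>x. x ^ j)"
      using \<epsilon> by (intro levy_moment_integrable[OF \<epsilon>(2)]) auto
  qed (use levy step_pos step_lim l in auto)
  show "weak_conv_m
      (\<lambda>n. distr M borel
         (\<lambda>\<omega>. sqrt (real n * \<Delta> n) * (c_hat L l n (\<Delta> n) \<omega> - c_lim \<sigma> \<nu> l)))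
      (normal_law 0 (c_lim \<sigma> \<nu> (2 * l)))"
    using * by (intro power_variation_clt horizon) simp
qed

end
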